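(* Consider the perishable-goods setting: there is a fixed life-time $c>0$ such that for every element $i$ and periods $1\le s\le t\le T$, $h^i_{st}=0$ if $t-c\le s\le t$ and $h^i_{st}=\infty$ if $s<t-c$ (so each demand $(i,t)$ can only be served by an order placed in $[t-c,t]$, and holding cost is otherwise negligible). Then there is a polynomial-time (LP-rounding) algorithm that is a $2$-approximation for the submodular Joint Replenishment Problem and a $(6+o(1))$-approximation for the Inventory Routing Problem in this setting.
   Context: Problem: there are $N$ elements $\mathcal{N}=\{1,\dots,N\}$ and periods $1,\dots,T$; each element $i$ has known demand $d_{it}\ge 0$ in period $t$, and $\mathcal{D}=\{(i,t):d_{it}>0\}$. In each period a joint order for a subset $S\subseteq\mathcal{N}$ may be placed at cost $f(S)$. Each $(i,t)\in\mathcal{D}$ must be served by an order containing $i$ placed in a period $s\le t$, incurring holding cost $d_{it}h^i_{st}$. Objective: minimize total ordering plus holding cost. Submodular JRP: $f$ is nonnegative, monotone nondecreasing and submodular (value oracle). IRP: there is a depot $r$ and a metric $w$ on $V=\mathcal{N}\cup\{r\}$, and $f(S)$ is the minimum length of a tour visiting all vertices of $S\cup\{r\}$. The $o(1)$ term tends to $0$ as the number of vertices grows. *)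

theory Defs
  imports
    "HOL-Analysis.Analysis"
    "HOL-Computational_Algebra.Polynomial"
    "HOL-Library.Log_Nat"
begin

section \<open>Joint replenishment\<close>

text \<open>
  Elements are \<open>1..N\<close> and periods are \<open>1..T\<close>.  All finite input data are rational, so that an
  instance is a finite object; holding costs may be infinite.  The arguments of \<open>holding\<close> are
  the element, the period of the order and the period of the demand.
\<close>

record jrp =
  num_elems   :: nat
  num_periods :: nat
  demand      :: "nat \<Rightarrow> nat \<Rightarrow> rat"
  holding     :: "nat \<Rightarrow> nat \<Rightarrow> nat \<Rightarrow> ennreal"
  order_cost  :: "nat set \<Rightarrow> rat"

definition elements :: "jrp \<Rightarrow> nat set" where
  "elements I = {1..num_elems I}"

definition nonneg_demand :: "jrp \<Rightarrow> bool" where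
  "nonneg_demand I \<longleftrightarrow> (\<forall>i\<in>elements I. \<forall>t\<in>{1..num_periods I}. 0 \<le> demand I i t)"

definition demand_points :: "jrp \<Rightarrow> (nat \<times> nat) set" where
  "demand_points I = {(i, t). i \<in> elements I \<and> t \<in> {1..num_periods I} \<and> 0 < demand I i t}"

text \<open>
  \<open>orders \<sigma> s\<close> is the set ordered jointly in period \<open>s\<close>, where the empty set means that no order
  is placed (so it is free even if \<open>order_cost I {} > 0\<close>); \<open>source \<sigma> i t\<close> is the period of the
  order serving demand \<open>(i, t)\<close>.
\<close>

record schedule =
  orders :: "nat \<Rightarrow> nat set"
  source :: "nat \<Rightarrow> nat \<Rightarrow> nat"

definition feasible :: "jrp \<Rightarrow> schedule \<Rightarrow> bool" where
  "feasible I \<sigma> \<longleftrightarrow>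
     (\<forall>s\<in>{1..num_periods I}. orders \<sigma> s \<subseteq> elements I) \<and>
     (\<forall>(i, t)\<in>demand_points I. source \<sigma> i t \<in> {1..t} \<and> i \<in> orders \<sigma> (source \<sigma> i t))"

definition total_cost :: "jrp \<Rightarrow> schedule \<Rightarrow> ennreal" where
  "total_cost I \<sigma> =
     (\<Sum>s\<in>{s\<in>{1..num_periods I}. orders \<sigma> s \<noteq> {}}. ennreal (real_of_rat (order_cost I (orders \<sigma> s)))) +
     (\<Sum>(i, t)\<in>demand_points I. ennreal (real_of_rat (demand I i t)) * holding I i (source \<sigma> i t) t)"

definition opt :: "jrp \<Rightarrow> ennreal" where
  "opt I = (INF \<sigma>\<in>{\<sigma>. feasible I \<sigma>}. total_cost I \<sigma>)"

definition approx_solution :: "real \<Rightarrow> jrp \<Rightarrow> schedule \<Rightarrow> bool" where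
  "approx_solution \<alpha> I \<sigma> \<longleftrightarrow> feasible I \<sigma> \<and> total_cost I \<sigma> \<le> ennreal \<alpha> * opt I"

definition perishable :: "rat \<Rightarrow> jrp \<Rightarrow> bool" where
  "perishable c I \<longleftrightarrow>
     (\<forall>i\<in>elements I. \<forall>t\<in>{1..num_periods I}. \<forall>s\<in>{1..t}.
        holding I i s t = (if of_nat t - c \<le> of_nat s then 0 else \<infinity>))"

definition submodular_jrp :: "jrp \<Rightarrow> bool" where
  "submodular_jrp I \<longleftrightarrow> nonneg_demand I \<and>
     (\<forall>A. A \<subseteq> elements I \<longrightarrow> 0 \<le> order_cost I A) \<and>
     (\<forall>A B. A \<subseteq> B \<and> B \<subseteq> elements I \<longrightarrow> order_cost I A \<le> order_cost I B) \<and>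
     (\<forall>A B. A \<subseteq> elements I \<and> B \<subseteq> elements I \<longrightarrow>
        order_cost I (A \<union> B) + order_cost I (A \<inter> B) \<le> order_cost I A + order_cost I B)"


section \<open>Inventory routing\<close>

text \<open>
  The depot is vertex \<open>0\<close>.  A tour is given by the cyclic sequence of the vertices it visits,
  each listed once; it may visit further vertices besides the required ones.
\<close>

definition tours :: "nat \<Rightarrow> nat set \<Rightarrow> nat list set" where
  "tours N S = {xs. distinct xs \<and> insert 0 S \<subseteq> set xs \<and> set xs \<subseteq> {0..N}}"

definition tour_length :: "(nat \<Rightarrow> nat \<Rightarrow> rat) \<Rightarrow> nat list \<Rightarrow> rat" where
  "tour_length w xs = (\<Sum>k<length xs. w (xs ! k) (xs ! (Suc k mod length xs)))"

definition irp :: "(nat \<Rightarrow> nat \<Rightarrow> rat) \<Rightarrow> jrp \<Rightarrow> bool" where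
  "irp w I \<longleftrightarrow> nonneg_demand I \<and>
     Metric_space {0..num_elems I} (\<lambda>u v. real_of_rat (w u v)) \<and>
     (\<forall>S. S \<subseteq> elements I \<longrightarrow> order_cost I S = Min (tour_length w ` tours (num_elems I) S))"


section \<open>Machine model\<close>

text \<open>
  A while language over binary trees with integer leaves, with oracle queries.  Every evaluation
  of a subexpression is charged the size of its result, integers being measured by their binary
  length, and a query is charged the size of the answer in addition to that of the question.
  Hence running time agrees up to a polynomial with that of oracle Turing machines.
\<close>

datatype val = VInt int | VPair val val

fun vsize :: "val \<Rightarrow> nat" where
  "vsize (VInt k) = 1 + floorlog 2 (nat \<bar>k\<bar>)"
| "vsize (VPair a b) = 1 + vsize a + vsize b"

fun int_of :: "val \<Rightarrow> int" where
  "int_of (VInt k) = k"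
| "int_of (VPair a b) = 0"

fun left_of :: "val \<Rightarrow> val" where
  "left_of (VInt k) = VInt 0"
| "left_of (VPair a b) = a"

fun right_of :: "val \<Rightarrow> val" where
  "right_of (VInt k) = VInt 0"
| "right_of (VPair a b) = b"

definition vbool :: "bool \<Rightarrow> val" where
  "vbool b = VInt (if b then 1 else 0)"

datatype expr =
    EVar nat
  | EInt int
  | EPair expr expr
  | ELeft expr
  | ERight expr
  | EIsPair expr
  | EAdd expr expr
  | ESub expr expr
  | EMul expr expr
  | EDiv expr expr
  | EMod expr expr
  | ELess expr expr
  | EEq expr expr

type_synonym state = "nat \<Rightarrow> val"

fun eval_expr :: "expr \<Rightarrow> state \<Rightarrow> val" where
  "eval_expr (EVar x) \<sigma> = \<sigma> x"
| "eval_expr (EInt k) \<sigma> = VInt k"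
| "eval_expr (EPair a b) \<sigma> = VPair (eval_expr a \<sigma>) (eval_expr b \<sigma>)"
| "eval_expr (ELeft a) \<sigma> = left_of (eval_expr a \<sigma>)"
| "eval_expr (ERight a) \<sigma> = right_of (eval_expr a \<sigma>)"
| "eval_expr (EIsPair a) \<sigma> = vbool (case eval_expr a \<sigma> of VInt k \<Rightarrow> False | VPair u v \<Rightarrow> True)"
| "eval_expr (EAdd a b) \<sigma> = VInt (int_of (eval_expr a \<sigma>) + int_of (eval_expr b \<sigma>))"
| "eval_expr (ESub a b) \<sigma> = VInt (int_of (eval_expr a \<sigma>) - int_of (eval_expr b \<sigma>))"
| "eval_expr (EMul a b) \<sigma> = VInt (int_of (eval_expr a \<sigma>) * int_of (eval_expr b \<sigma>))"
| "eval_expr (EDiv a b) \<sigma> = VInt (int_of (eval_expr a \<sigma>) div int_of (eval_expr b \<sigma>))"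
| "eval_expr (EMod a b) \<sigma> = VInt (int_of (eval_expr a \<sigma>) mod int_of (eval_expr b \<sigma>))"
| "eval_expr (ELess a b) \<sigma> = vbool (int_of (eval_expr a \<sigma>) < int_of (eval_expr b \<sigma>))"
| "eval_expr (EEq a b) \<sigma> = vbool (eval_expr a \<sigma> = eval_expr b \<sigma>)"

fun subexprs_cost :: "expr \<Rightarrow> state \<Rightarrow> nat"
and expr_cost :: "expr \<Rightarrow> state \<Rightarrow> nat" where
  "subexprs_cost (EVar x) \<sigma> = 0"
| "subexprs_cost (EInt k) \<sigma> = 0"
| "subexprs_cost (EPair a b) \<sigma> = expr_cost a \<sigma> + expr_cost b \<sigma>"
| "subexprs_cost (ELeft a) \<sigma> = expr_cost a \<sigma>"
| "subexprs_cost (ERight a) \<sigma> = expr_cost a \<sigma>"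
| "subexprs_cost (EIsPair a) \<sigma> = expr_cost a \<sigma>"
| "subexprs_cost (EAdd a b) \<sigma> = expr_cost a \<sigma> + expr_cost b \<sigma>"
| "subexprs_cost (ESub a b) \<sigma> = expr_cost a \<sigma> + expr_cost b \<sigma>"
| "subexprs_cost (EMul a b) \<sigma> = expr_cost a \<sigma> + expr_cost b \<sigma>"
| "subexprs_cost (EDiv a b) \<sigma> = expr_cost a \<sigma> + expr_cost b \<sigma>"
| "subexprs_cost (EMod a b) \<sigma> = expr_cost a \<sigma> + expr_cost b \<sigma>"
| "subexprs_cost (ELess a b) \<sigma> = expr_cost a \<sigma> + expr_cost b \<sigma>"
| "subexprs_cost (EEq a b) \<sigma> = expr_cost a \<sigma> + expr_cost b \<sigma>"
| "expr_cost e \<sigma> = subexprs_cost e \<sigma> + vsize (eval_expr e \<sigma>)"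

datatype com =
    Skip
  | Assign nat expr
  | Query nat expr
  | Seq com com
  | Cond expr com com
  | While expr com

abbreviation holds :: "expr \<Rightarrow> state \<Rightarrow> bool" where
  "holds e \<sigma> \<equiv> eval_expr e \<sigma> \<noteq> VInt 0"

text \<open>\<open>exec ora P \<sigma> n \<sigma>'\<close>: started in \<open>\<sigma>\<close>, program \<open>P\<close> stops in \<open>\<sigma>'\<close> after time \<open>n\<close>.\<close>

inductive exec :: "(val \<Rightarrow> val) \<Rightarrow> com \<Rightarrow> state \<Rightarrow> nat \<Rightarrow> state \<Rightarrow> bool"
  for ora :: "val \<Rightarrow> val" where
  exec_Skip: "exec ora Skip \<sigma> 1 \<sigma>"
| exec_Assign: "exec ora (Assign x e) \<sigma> (1 + expr_cost e \<sigma>) (\<sigma>(x := eval_expr e \<sigma>))"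
| exec_Query: "a = ora (eval_expr e \<sigma>) \<Longrightarrow>
    exec ora (Query x e) \<sigma> (1 + expr_cost e \<sigma> + vsize a) (\<sigma>(x := a))"
| exec_Seq: "exec ora P \<sigma> m \<sigma>' \<Longrightarrow> exec ora Q \<sigma>' n \<sigma>'' \<Longrightarrow>
    exec ora (Seq P Q) \<sigma> (1 + m + n) \<sigma>''"
| exec_CondT: "holds e \<sigma> \<Longrightarrow> exec ora P \<sigma> n \<sigma>' \<Longrightarrow>
    exec ora (Cond e P Q) \<sigma> (1 + expr_cost e \<sigma> + n) \<sigma>'"
| exec_CondF: "\<not> holds e \<sigma> \<Longrightarrow> exec ora Q \<sigma> n \<sigma>' \<Longrightarrow>
    exec ora (Cond e P Q) \<sigma> (1 + expr_cost e \<sigma> + n) \<sigma>'"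
| exec_WhileF: "\<not> holds e \<sigma> \<Longrightarrow> exec ora (While e P) \<sigma> (1 + expr_cost e \<sigma>) \<sigma>"
| exec_WhileT: "holds e \<sigma> \<Longrightarrow> exec ora P \<sigma> m \<sigma>' \<Longrightarrow> exec ora (While e P) \<sigma>' n \<sigma>'' \<Longrightarrow>
    exec ora (While e P) \<sigma> (1 + expr_cost e \<sigma> + m + n) \<sigma>''"

inductive_cases exec_elims:
  "exec ora Skip \<sigma> n \<sigma>'"
  "exec ora (Assign x e) \<sigma> n \<sigma>'"
  "exec ora (Query x e) \<sigma> n \<sigma>'"
  "exec ora (Seq P Q) \<sigma> n \<sigma>'"
  "exec ora (Cond e P Q) \<sigma> n \<sigma>'"

inductive_cases exec_While_elim: "exec ora (While e P) \<sigma> n \<sigma>'"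

lemma exec_deterministic:
  "exec ora P \<sigma> m \<sigma>1 \<Longrightarrow> exec ora P \<sigma> n \<sigma>2 \<Longrightarrow> m = n \<and> \<sigma>1 = \<sigma>2"
proof (induction arbitrary: n \<sigma>2 rule: exec.induct)
  case (exec_Skip \<sigma>)
  from exec_Skip.prems show ?case by (rule exec_elims) simp
next
  case (exec_Assign x e \<sigma>)
  from exec_Assign.prems show ?case by (rule exec_elims) simp
next
  case (exec_Query a e \<sigma> x)
  from exec_Query.prems exec_Query.hyps show ?case by (elim exec_elims) simp
next
  case (exec_Seq P \<sigma> m \<sigma>' Q k \<sigma>'')
  from exec_Seq.prems obtain m' k' \<tau> where
    "exec ora P \<sigma> m' \<tau>" "exec ora Q \<tau> k' \<sigma>2" "n = 1 + m' + k'"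
    by (rule exec_elims) simp
  with exec_Seq.IH show ?case by blast
next
  case (exec_CondT e \<sigma> P k \<sigma>' Q)
  from exec_CondT.prems exec_CondT.hyps(1) obtain k' where
    "exec ora P \<sigma> k' \<sigma>2" "n = 1 + expr_cost e \<sigma> + k'"
    by (elim exec_elims) simp_all
  with exec_CondT.IH show ?case by blast
next
  case (exec_CondF e \<sigma> Q k \<sigma>' P)
  from exec_CondF.prems exec_CondF.hyps(1) obtain k' where
    "exec ora Q \<sigma> k' \<sigma>2" "n = 1 + expr_cost e \<sigma> + k'"
    by (elim exec_elims) simp_all
  with exec_CondF.IH show ?case by blast
next
  case (exec_WhileF e \<sigma> P)
  from exec_WhileF.prems exec_WhileF.hyps show ?case by (auto elim: exec_While_elim)
next
  case (exec_WhileT e \<sigma> P m \<sigma>' k \<sigma>'')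
  from exec_WhileT.prems exec_WhileT.hyps(1) obtain m' k' \<tau> where
    "exec ora P \<sigma> m' \<tau>" "exec ora (While e P) \<tau> k' \<sigma>2" "n = 1 + expr_cost e \<sigma> + m' + k'"
    by (auto elim: exec_While_elim)
  with exec_WhileT.IH show ?case by blast
qed

text \<open>The input is passed, and the output returned, in variable \<open>0\<close>.\<close>

definition computes :: "(val \<Rightarrow> val) \<Rightarrow> com \<Rightarrow> val \<Rightarrow> nat \<Rightarrow> val \<Rightarrow> bool" where
  "computes ora P inp n out \<longleftrightarrow>
     (\<exists>\<sigma>. exec ora P ((\<lambda>_. VInt 0)(0 := inp)) n \<sigma> \<and> \<sigma> 0 = out)"


section \<open>Encodings\<close>

definition enc_nat :: "nat \<Rightarrow> val" where
  "enc_nat n = VInt (int n)"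

definition enc_rat :: "rat \<Rightarrow> val" where
  "enc_rat q = VPair (VInt (fst (quotient_of q))) (VInt (snd (quotient_of q)))"

definition enc_list :: "val list \<Rightarrow> val" where
  "enc_list vs = foldr VPair vs (VInt 0)"

definition enc_matrix :: "(nat \<Rightarrow> nat \<Rightarrow> rat) \<Rightarrow> nat list \<Rightarrow> nat list \<Rightarrow> val" where
  "enc_matrix a is js = enc_list (map (\<lambda>i. enc_list (map (\<lambda>j. enc_rat (a i j)) js)) is)"

text \<open>In the perishable setting the life-time \<open>c\<close> determines all holding costs.\<close>

definition enc_perishable :: "rat \<Rightarrow> jrp \<Rightarrow> val" where
  "enc_perishable c I = enc_list
     [enc_nat (num_elems I), enc_nat (num_periods I), enc_rat c,
      enc_matrix (demand I) [1..<Suc (num_elems I)] [1..<Suc (num_periods I)]]"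

definition enc_perishable_irp :: "rat \<Rightarrow> (nat \<Rightarrow> nat \<Rightarrow> rat) \<Rightarrow> jrp \<Rightarrow> val" where
  "enc_perishable_irp c w I = enc_list
     [enc_perishable c I, enc_matrix w [0..<Suc (num_elems I)] [0..<Suc (num_elems I)]]"

text \<open>A set is represented by any list of its elements.\<close>

fun dec_set :: "val \<Rightarrow> nat set" where
  "dec_set (VInt k) = {}"
| "dec_set (VPair a b) = insert (nat (int_of a)) (dec_set b)"

text \<open>Entry \<open>k\<close> of a list, counted from \<open>0\<close>; past the end the result is \<open>VInt 0\<close>.\<close>

definition dec_nth :: "val \<Rightarrow> nat \<Rightarrow> val" where
  "dec_nth v k = left_of ((right_of ^^ k) v)"

text \<open>The output is a pair of the list of order sets and the matrix of serving periods.\<close>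

definition dec_schedule :: "val \<Rightarrow> schedule" where
  "dec_schedule v =
     \<lparr>orders = (\<lambda>s. dec_set (dec_nth (left_of v) (s - 1))),
      source = (\<lambda>i t. nat (int_of (dec_nth (dec_nth (right_of v) (i - 1)) (t - 1))))\<rparr>"

definition value_oracle :: "jrp \<Rightarrow> val \<Rightarrow> val" where
  "value_oracle I v = enc_rat (order_cost I (dec_set v \<inter> elements I))"

text \<open>As usual for oracle algorithms, the largest encoding length of an oracle value counts
  towards the input size.\<close>

definition max_value_size :: "jrp \<Rightarrow> nat" where
  "max_value_size I = Max ((\<lambda>S. vsize (enc_rat (order_cost I S))) ` Pow (elements I))"

definition no_oracle :: "val \<Rightarrow> val" where
  "no_oracle v = VInt 0"

end

theory Submission
  imports Defs
begin

text \<open>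
  Let \<open>K = \<lfloor>c\<rfloor> + 1\<close>.  Every demand \<open>(i, t)\<close> is served at the start of its block of \<open>K\<close> periods,
  that is, at the last of the periods \<open>1, 1 + K, 1 + 2 K, \<dots>\<close> that is not after \<open>t\<close>.  Any feasible
  schedule of finite cost serves the demands of the block starting at \<open>s\<close> by orders strictly
  between \<open>s - K\<close> and \<open>s + K\<close>, so monotonicity and subadditivity bound the order placed at \<open>s\<close> by
  these orders.  As every period is that close to at most two block starts, the total is at most
  twice the optimum.  Minimum tour lengths are subadditive too (join two tours at the depot and
  take shortcuts), so the same rule is a 2-approximation for inventory routing, and neither the
  value oracle nor a linear program is needed.
\<close>

section \<open>Approximation guarantee\<close>

text \<open>The block length is the largest that the life-time permits: the last period of a block
  lies \<open>K - 1 = \<lfloor>c\<rfloor>\<close> periods after the first, so an order at the start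
  is still just fresh enough for it. Minimum tour lengths are not submodular in general;
  monotonicity and subadditivity are what both cost models share, and the charging argument is
  carried out for that common property. The obstacle in the second half is the running time. The
  machine charges the size of every value, and a loop body that may enlarge the state by a constant
  factor would compound to an exponential bound over many iterations. Every loop is therefore
  analysed under one bound \<open>B\<close> for the whole state that is fixed in advance.
  Accumulators only grow, so bounding their final contents bounds them at all times, and the final
  contents are polynomial in the input.\<close>

definition monotone_subadditive_cost :: "jrp \<Rightarrow> bool" where
  "monotone_subadditive_cost I \<longleftrightarrow>
     (\<forall>A. A \<subseteq> elements I \<longrightarrow> 0 \<le> order_cost I A) \<and>
     (\<forall>A B. A \<subseteq> B \<and> B \<subseteq> elements I \<longrightarrow> order_cost I A \<le> order_cost I B) \<and>
     (\<forall>A B. A \<subseteq> elements I \<and> B \<subseteq> elements I \<longrightarrow>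
        order_cost I (A \<union> B) \<le> order_cost I A + order_cost I B)"

lemma submodular_jrp_monotone_subadditive:
  assumes "submodular_jrp I"
  shows "monotone_subadditive_cost I"
  unfolding monotone_subadditive_cost_def
proof (intro conjI allI impI)
  fix A B assume AB: "A \<subseteq> elements I \<and> B \<subseteq> elements I"
  then have "A \<inter> B \<subseteq> elements I" by blast
  with assms have "0 \<le> order_cost I (A \<inter> B)"
    by (auto simp: submodular_jrp_def)
  moreover have "order_cost I (A \<union> B) + order_cost I (A \<inter> B) \<le> order_cost I A + order_cost I B"
    using assms AB by (auto simp: submodular_jrp_def)
  ultimately show "order_cost I (A \<union> B) \<le> order_cost I A + order_cost I B" by linarith
qed (use assms in \<open>auto simp: submodular_jrp_def\<close>)

text \<open>\<open>U \<noteq> {}\<close> matters: the empty union costs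
  \<open>order_cost I {}\<close>, which may be positive, against an empty sum.\<close>

lemma order_cost_Union_le:
  assumes "monotone_subadditive_cost I" "finite U" "U \<noteq> {}"
    and "\<And>u. u \<in> U \<Longrightarrow> S u \<subseteq> elements I"
  shows "order_cost I (\<Union>u\<in>U. S u) \<le> (\<Sum>u\<in>U. order_cost I (S u))"
  using assms(2-4)
proof (induction U rule: finite_ne_induct)
  case (insert u U)
  have "order_cost I (S u \<union> (\<Union>u\<in>U. S u)) \<le> order_cost I (S u) + order_cost I (\<Union>u\<in>U. S u)"
  proof -
    have "S u \<subseteq> elements I" "(\<Union>u\<in>U. S u) \<subseteq> elements I" using insert.prems by auto
    with assms(1) show ?thesis by (simp add: monotone_subadditive_cost_def)
  qed
  with insert show ?case by simp
qed simp

section \<open>Blocks of periods and the charging argument\<close>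

text \<open>Periods are numbered from 1, so starts are congruent to 1 modulo \<open>K\<close>; hence
  the shift by 1 before taking the remainder.\<close>

definition block_start :: "nat \<Rightarrow> nat \<Rightarrow> nat" where
  "block_start K t = t - (t - 1) mod K"

lemma block_start_bounds:
  assumes "0 < K" "1 \<le> t"
  shows "1 \<le> block_start K t" "block_start K t \<le> t" "t < block_start K t + K"
    "K dvd block_start K t - 1"
proof -
  have *: "(t - 1) mod K < K" "(t - 1) mod K \<le> t - 1" using assms by auto
  then show "1 \<le> block_start K t" "block_start K t \<le> t" "t < block_start K t + K"
    using assms(2) unfolding block_start_def by linarith+
  have "block_start K t - 1 = (t - 1) - (t - 1) mod K"
    unfolding block_start_def by (rule diff_commute)
  then show "K dvd block_start K t - 1" by (simp only: dvd_minus_mod)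
qed

text \<open>The two strict inequalities leave a window of \<open>2 * K - 1\<close> consecutive
  numbers, which contains at most two members of a residue class modulo \<open>K\<close>. This is
  the origin of the factor 2.\<close>

lemma card_near_block_starts:
  fixes u :: nat
  assumes K: "0 < K" and u: "1 \<le> u"
  shows "card {s \<in> {1..T}. K dvd s - 1 \<and> s < u + K \<and> u < s + K} \<le> 2"
proof -
  let ?q = "(u - 1) div K"
  have "{s \<in> {1..T}. K dvd s - 1 \<and> s < u + K \<and> u < s + K} \<subseteq> {1 + K * ?q, 1 + K * (?q + 1)}"
  proof
    fix s assume "s \<in> {s \<in> {1..T}. K dvd s - 1 \<and> s < u + K \<and> u < s + K}"
    then have s1: "1 \<le> s" "K dvd s - 1" and su: "s < u + K" "u < s + K" by auto
    from s1(2) obtain j where "s - 1 = K * j" by (elim dvdE)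
    with s1(1) have s: "s = 1 + K * j" by linarith
    have dm: "u - 1 = K * ?q + (u - 1) mod K" and r: "(u - 1) mod K < K"
      using K by simp_all
    \<comment> \<open>The candidates are the start of the block of \<open>u\<close> itself,
      \<open>j = ?q\<close>, and the start of the next block, \<open>j = ?q + 1\<close>.\<close>
    have "K * j < K * (?q + 2)" using s su dm r u unfolding distrib_left by linarith
    moreover have "K * ?q < K * (j + 1)" using s su dm r u unfolding distrib_left by linarith
    ultimately have "j = ?q \<or> j = ?q + 1"
      unfolding nat_mult_less_cancel_disj by linarith
    with s show "s \<in> {1 + K * ?q, 1 + K * (?q + 1)}" by auto
  qed
  then have "card {s \<in> {1..T}. K dvd s - 1 \<and> s < u + K \<and> u < s + K}
      \<le> card {1 + K * ?q, 1 + K * (?q + 1)}"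
    by (rule card_mono[rotated]) simp
  also have "\<dots> \<le> 2" by (simp add: card_insert_if)
  finally show ?thesis .
qed

lemma finite_demand_points: "finite (demand_points I)"
  by (rule finite_subset[of _ "elements I \<times> {1..num_periods I}"])
    (auto simp: demand_points_def elements_def)

definition block_orders :: "nat \<Rightarrow> jrp \<Rightarrow> nat \<Rightarrow> nat set" where
  "block_orders K I s = {i. \<exists>t. (i, t) \<in> demand_points I \<and> block_start K t = s}"

lemma block_orders_subset: "block_orders K I s \<subseteq> elements I"
  by (auto simp: block_orders_def demand_points_def)

text \<open>An order of period \<open>u\<close> can serve only demands of the two blocks that meet
  \<open>{u..<u + K}\<close>, so it is charged at most twice.\<close>

lemma block_orders_cost_le:
  assumes cost: "monotone_subadditive_cost I" and K: "0 < K" and feas: "feasible I \<tau>"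
    and near: "\<And>i t. (i, t) \<in> demand_points I \<Longrightarrow> t < source \<tau> i t + K"
  shows "(\<Sum>s\<in>{s\<in>{1..num_periods I}. block_orders K I s \<noteq> {}}. order_cost I (block_orders K I s))
    \<le> 2 * (\<Sum>u\<in>{u\<in>{1..num_periods I}. orders \<tau> u \<noteq> {}}. order_cost I (orders \<tau> u))"
proof -
  let ?T = "{1..num_periods I}"
  let ?G = "{s\<in>?T. block_orders K I s \<noteq> {}}"
  let ?A = "{u\<in>?T. orders \<tau> u \<noteq> {}}"
  let ?near = "\<lambda>s u. s < u + K \<and> u < s + K"
  have sub: "orders \<tau> u \<subseteq> elements I" if "u \<in> ?T" for u
    using feas that by (auto simp: feasible_def)
  have nonneg: "0 \<le> order_cost I (orders \<tau> u)" if "u \<in> ?T" for u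
    using cost sub[OF that] by (auto simp: monotone_subadditive_cost_def)
  have dvd: "K dvd s - 1" if "s \<in> ?G" for s
    using that block_start_bounds(4)[OF K] by (auto simp: block_orders_def demand_points_def)
  have cover: "order_cost I (block_orders K I s) \<le> (\<Sum>u\<in>{u\<in>?A. ?near s u}. order_cost I (orders \<tau> u))"
    if s: "s \<in> ?G" for s
  proof -
    have *: "block_orders K I s \<subseteq> (\<Union>u\<in>{u\<in>?A. ?near s u}. orders \<tau> u)"
    proof
      fix i assume "i \<in> block_orders K I s"
      then obtain t where it: "(i, t) \<in> demand_points I" and bs: "block_start K t = s"
        by (auto simp: block_orders_def)
      have t: "1 \<le> t" "t \<le> num_periods I" using it by (auto simp: demand_points_def)
      let ?u = "source \<tau> i t"
      have u: "?u \<in> {1..t}" "i \<in> orders \<tau> ?u"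
        using feas it by (auto simp: feasible_def)
      \<comment> \<open>\<open>?u \<le> t < s + K\<close> since \<open>t\<close> lies in the block
        of \<open>s\<close>, and \<open>s \<le> t < ?u + K\<close> since the demand is served within
        its life-time.\<close>
      have "?near s ?u"
        using u(1) near[OF it] block_start_bounds[OF K t(1)] bs by auto
      with u t show "i \<in> (\<Union>u\<in>{u\<in>?A. ?near s u}. orders \<tau> u)" by auto
    qed
    moreover have "(\<Union>u\<in>{u\<in>?A. ?near s u}. orders \<tau> u) \<subseteq> elements I" using sub by auto
    ultimately have "order_cost I (block_orders K I s)
        \<le> order_cost I (\<Union>u\<in>{u\<in>?A. ?near s u}. orders \<tau> u)"
      using cost by (simp only: monotone_subadditive_cost_def)
    also have "\<dots> \<le> (\<Sum>u\<in>{u\<in>?A. ?near s u}. order_cost I (orders \<tau> u))"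
    proof (rule order_cost_Union_le[OF cost])
      \<comment> \<open>A nonempty set needs a nonempty cover, which supplies the premise of the
        union bound.\<close>
      have "block_orders K I s \<noteq> {}" using s by simp
      with * show "{u\<in>?A. ?near s u} \<noteq> {}" by blast
    qed (use sub in auto)
    finally show ?thesis .
  qed
  have "(\<Sum>s\<in>?G. order_cost I (block_orders K I s))
      \<le> (\<Sum>s\<in>?G. \<Sum>u\<in>{u\<in>?A. ?near s u}. order_cost I (orders \<tau> u))"
    by (rule sum_mono[OF cover])
  also have "\<dots> = (\<Sum>s\<in>?G. \<Sum>u\<in>?A. if ?near s u then order_cost I (orders \<tau> u) else 0)"
    by (intro sum.cong refl sum.inter_filter) auto
  \<comment> \<open>After the exchange, each order of \<open>\<tau>\<close> is counted once for
    every block start near it.\<close>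
  also have "\<dots> = (\<Sum>u\<in>?A. \<Sum>s\<in>?G. if ?near s u then order_cost I (orders \<tau> u) else 0)"
    by (rule sum.swap)
  also have "\<dots> = (\<Sum>u\<in>?A. of_nat (card {s\<in>?G. ?near s u}) * order_cost I (orders \<tau> u))"
    by (intro sum.cong refl, subst sum.inter_filter[symmetric]) auto
  also have "\<dots> \<le> (\<Sum>u\<in>?A. 2 * order_cost I (orders \<tau> u))"
  proof (rule sum_mono)
    fix u assume u: "u \<in> ?A"
    have "card {s\<in>?G. ?near s u} \<le> card {s \<in> ?T. K dvd s - 1 \<and> s < u + K \<and> u < s + K}"
      by (rule card_mono) (use dvd in auto)
    also have "\<dots> \<le> 2" by (rule card_near_block_starts[OF K]) (use u in auto)
    finally have "(of_nat (card {s\<in>?G. ?near s u}) :: rat) \<le> 2" by linarith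
    then show "of_nat (card {s\<in>?G. ?near s u}) * order_cost I (orders \<tau> u)
        \<le> 2 * order_cost I (orders \<tau> u)"
      by (rule mult_right_mono) (use nonneg u in auto)
  qed
  finally show ?thesis by (simp add: sum_distrib_left)
qed

definition life_periods :: "rat \<Rightarrow> nat" where
  "life_periods c = Suc (nat \<lfloor>c\<rfloor>)"

text \<open>Periods are integers, so only \<open>\<lfloor>c\<rfloor>\<close> matters, and the
  non-strict bound by \<open>c\<close> becomes a strict one by
  \<open>\<lfloor>c\<rfloor> + 1\<close>.\<close>

lemma within_life_iff:
  assumes "0 < c" "s \<le> t"
  shows "of_nat t - c \<le> of_nat s \<longleftrightarrow> t < s + life_periods c"
proof -
  have "of_nat t - c \<le> of_nat s \<longleftrightarrow> of_int (int t - int s) \<le> c"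
    by (auto simp: algebra_simps)
  also have "\<dots> \<longleftrightarrow> int t - int s \<le> \<lfloor>c\<rfloor>" by (rule le_floor_iff[symmetric])
  also have "\<dots> \<longleftrightarrow> t < s + life_periods c"
    using assms by (simp add: life_periods_def) linarith
  finally show ?thesis .
qed

text \<open>Agreement with the block rule is demanded only on periods and demand points of the
  instance, because a schedule decoded from a finite output takes default values elsewhere. A
  general \<open>\<alpha>\<close> covers both 2 and 6.\<close>

lemma block_schedule_approx:
  assumes cost: "monotone_subadditive_cost I" and c: "0 < c" and per: "perishable c I"
    and ord: "\<And>s. s \<in> {1..num_periods I} \<Longrightarrow> orders \<sigma> s = block_orders (life_periods c) I s"
    and src: "\<And>i t. (i, t) \<in> demand_points I \<Longrightarrow> source \<sigma> i t = block_start (life_periods c) t"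
    and \<alpha>: "2 \<le> \<alpha>"
  shows "approx_solution \<alpha> I \<sigma>"
proof -
  define K where "K = life_periods c"
  have K: "0 < K" by (simp add: K_def life_periods_def)
  note ord = ord[folded K_def] and src = src[folded K_def]
  have hold: "holding I i s t = (if t < s + K then 0 else \<infinity>)"
    if "(i, t) \<in> demand_points I" "s \<in> {1..t}" for i s t
    using per that within_life_iff[OF c, of s t]
    by (auto simp: perishable_def demand_points_def K_def)
  have feas: "feasible I \<sigma>"
    unfolding feasible_def
  proof safe
    fix s i assume "s \<in> {1..num_periods I}" "i \<in> orders \<sigma> s"
    then show "i \<in> elements I" using ord block_orders_subset by blast
  next
    fix i t assume it: "(i, t) \<in> demand_points I"
    then have t: "1 \<le> t" "t \<le> num_periods I" by (auto simp: demand_points_def)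
    note b = block_start_bounds[OF K t(1)]
    then show "source \<sigma> i t \<in> {1..t}" using src[OF it] by simp
    have "block_start K t \<in> {1..num_periods I}" using b t by simp
    then show "i \<in> orders \<sigma> (source \<sigma> i t)"
      using src[OF it] ord it by (auto simp: block_orders_def)
  qed
  let ?G = "{s\<in>{1..num_periods I}. block_orders K I s \<noteq> {}}"
  have nonneg: "0 \<le> order_cost I A" if "A \<subseteq> elements I" for A
    using cost that by (auto simp: monotone_subadditive_cost_def)
  have G: "{s\<in>{1..num_periods I}. orders \<sigma> s \<noteq> {}} = ?G" using ord by auto
  have hc: "(\<Sum>(i, t)\<in>demand_points I.
      ennreal (real_of_rat (demand I i t)) * holding I i (source \<sigma> i t) t) = 0"
  proof (rule sum.neutral, clarify)
    fix i t assume it: "(i, t) \<in> demand_points I"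
    then have t: "1 \<le> t" by (auto simp: demand_points_def)
    show "ennreal (real_of_rat (demand I i t)) * holding I i (source \<sigma> i t) t = 0"
      using block_start_bounds[OF K t] src[OF it] hold[OF it, of "block_start K t"] by simp
  qed
  \<comment> \<open>With no holding cost left, the total is a rational number, so the charging
    argument can take place in \<open>rat\<close>.\<close>
  have tc: "total_cost I \<sigma> = ennreal (real_of_rat (\<Sum>s\<in>?G. order_cost I (block_orders K I s)))"
    unfolding total_cost_def hc G of_rat_sum
    by (subst sum_ennreal[symmetric])
      (auto simp: nonneg block_orders_subset ord intro!: sum.cong)
  have bound: "total_cost I \<sigma> \<le> 2 * total_cost I \<tau>" if feas\<tau>: "feasible I \<tau>" for \<tau>
  proof (cases "\<forall>(i, t)\<in>demand_points I. t < source \<tau> i t + K")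
    case True
    let ?A = "{u\<in>{1..num_periods I}. orders \<tau> u \<noteq> {}}"
    have n: "0 \<le> order_cost I (orders \<tau> u)" if "u \<in> ?A" for u
      by (rule nonneg) (use feas\<tau> that in \<open>auto simp: feasible_def\<close>)
    have "total_cost I \<sigma> \<le> ennreal (real_of_rat (2 * (\<Sum>u\<in>?A. order_cost I (orders \<tau> u))))"
      unfolding tc
    proof (intro ennreal_leI, subst of_rat_less_eq, rule block_orders_cost_le[OF cost K feas\<tau>])
      show "t < source \<tau> i t + K" if "(i, t) \<in> demand_points I" for i t
        using True that by blast
    qed
    also have "\<dots> = 2 * (\<Sum>u\<in>?A. ennreal (real_of_rat (order_cost I (orders \<tau> u))))"
      by (subst sum_ennreal) (use n in \<open>auto simp: of_rat_mult of_rat_sum ennreal_mult'\<close>)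
    also have "\<dots> \<le> 2 * total_cost I \<tau>"
      unfolding total_cost_def by (intro mult_left_mono) auto
    finally show ?thesis .
  next
    case False
    then obtain i t where it: "(i, t) \<in> demand_points I" and far: "\<not> t < source \<tau> i t + K" by auto
    have "source \<tau> i t \<in> {1..t}" using feas\<tau> it by (auto simp: feasible_def)
    then have "holding I i (source \<tau> i t) t = \<infinity>" using hold it far by simp
    \<comment> \<open>Positivity is essential here: in \<open>ennreal\<close>, zero times infinity
      is zero.\<close>
    moreover have "0 < demand I i t" using it by (simp add: demand_points_def)
    ultimately have "(\<Sum>(i, t)\<in>demand_points I.
        ennreal (real_of_rat (demand I i t)) * holding I i (source \<tau> i t) t) = top"
      using it finite_demand_points
      by (subst ennreal_sum_eq_top) (auto simp: ennreal_mult_eq_top_iff intro!: bexI[of _ "(i, t)"])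
    then show ?thesis by (simp add: total_cost_def ennreal_mult_top)
  qed
  have "total_cost I \<sigma> \<le> ennreal 2 * opt I"
  proof -
    have "ennreal (1 / 2) * ennreal 2 = ennreal (1 / 2 * 2)"
      by (rule ennreal_mult'[symmetric]) simp
    then have half: "ennreal (1 / 2) * ennreal 2 = 1" "ennreal 2 * ennreal (1 / 2) = 1"
      by (simp_all only: mult.commute[of "ennreal 2"]) simp_all
    \<comment> \<open>\<open>opt\<close> is an infimum, so the factor 2 is moved to the left to
      obtain a lower bound on every \<open>total_cost I \<tau>\<close>.\<close>
    have "ennreal (1 / 2) * total_cost I \<sigma> \<le> opt I"
      unfolding opt_def
    proof (rule INF_greatest)
      fix \<tau> assume "\<tau> \<in> {\<tau>. feasible I \<tau>}"
      then have "ennreal (1 / 2) * total_cost I \<sigma> \<le> ennreal (1 / 2) * (ennreal 2 * total_cost I \<tau>)"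
        using bound by (intro mult_left_mono) auto
      also have "\<dots> = total_cost I \<tau>"
        unfolding mult.assoc[symmetric] half by simp
      finally show "ennreal (1 / 2) * total_cost I \<sigma> \<le> total_cost I \<tau>" .
    qed
    then have "ennreal 2 * (ennreal (1 / 2) * total_cost I \<sigma>) \<le> ennreal 2 * opt I"
      by (intro mult_left_mono) auto
    then show ?thesis
      unfolding mult.assoc[symmetric] half by simp
  qed
  also have "\<dots> \<le> ennreal \<alpha> * opt I"
    by (intro mult_right_mono ennreal_leI \<alpha>) auto
  finally show ?thesis using feas by (simp add: approx_solution_def)
qed


section \<open>Tours\<close>

text \<open>Open paths avoid the cyclic index arithmetic of \<open>tour_length\<close>: a tour
  starting at \<open>a\<close> is a walk with both ends \<open>a\<close>, and walks split at any
  inner vertex.\<close>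

fun walk :: "(nat \<Rightarrow> nat \<Rightarrow> rat) \<Rightarrow> nat \<Rightarrow> nat list \<Rightarrow> nat \<Rightarrow> rat" where
  "walk w a [] b = w a b"
| "walk w a (x # xs) b = w a x + walk w x xs b"

lemma walk_append: "walk w a (xs @ y # ys) b = walk w a xs y + walk w y ys b"
  by (induction xs arbitrary: a) auto

lemma walk_eq_sum:
  "walk w a xs b = (\<Sum>k<Suc (length xs). w ((a # xs) ! k) ((xs @ [b]) ! k))"
proof (induction xs arbitrary: a)
  case (Cons x xs)
  show ?case
    by (simp only: walk.simps Cons length_Cons, subst (2) sum.lessThan_Suc_shift) simp
qed simp

lemma tour_length_Cons: "tour_length w (a # xs) = walk w a xs a"
  unfolding tour_length_def walk_eq_sum
proof (rule sum.cong)
  fix k assume "k \<in> {..<Suc (length xs)}"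
  \<comment> \<open>Only the last edge wraps around the modulus.\<close>
  then consider "k < length xs" | "k = length xs" by fastforce
  then show "w ((a # xs) ! k) ((a # xs) ! (Suc k mod length (a # xs)))
      = w ((a # xs) ! k) ((xs @ [a]) ! k)"
    by cases (auto simp: nth_append)
qed simp

lemma tour_length_rotate: "tour_length w (xs @ ys) = tour_length w (ys @ xs)"
proof (cases "xs = [] \<or> ys = []")
  case False
  then obtain x xs' y ys' where "xs = x # xs'" "ys = y # ys'" by (meson list.exhaust)
  then show ?thesis by (simp add: tour_length_Cons walk_append)
qed auto

locale rat_metric =
  fixes V :: "nat set" and w :: "nat \<Rightarrow> nat \<Rightarrow> rat"
  assumes metric: "Metric_space V (\<lambda>u v. real_of_rat (w u v))"
begin

lemma nonneg: "0 \<le> w u v"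
  using Metric_space.nonneg[OF metric, of u v] by simp

lemma zero: "u \<in> V \<Longrightarrow> w u u = 0"
  using Metric_space.zero[OF metric, of u u] by simp

lemma triangle: "\<lbrakk>u \<in> V; v \<in> V; x \<in> V\<rbrakk> \<Longrightarrow> w u x \<le> w u v + w v x"
  using Metric_space.triangle[OF metric, of u v x]
  by (metis of_rat_add of_rat_less_eq)

lemma walk_le_detour_start:
  "\<lbrakk>a \<in> V; x \<in> V; b \<in> V; set xs \<subseteq> V\<rbrakk> \<Longrightarrow> walk w a xs b \<le> w a x + walk w x xs b"
  by (cases xs) (simp_all add: triangle add.assoc[symmetric])

lemma walk_le_detour_end:
  "\<lbrakk>a \<in> V; x \<in> V; b \<in> V; set xs \<subseteq> V\<rbrakk> \<Longrightarrow> walk w a xs b \<le> walk w a xs x + w x b"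
  by (induction xs arbitrary: a) (auto simp: triangle add.assoc)

text \<open>Each deleted vertex is bypassed by the triangle inequality.\<close>

lemma walk_filter_le:
  "\<lbrakk>a \<in> V; b \<in> V; set xs \<subseteq> V\<rbrakk> \<Longrightarrow> walk w a (filter P xs) b \<le> walk w a xs b"
proof (induction xs arbitrary: a)
  case (Cons x xs)
  have "walk w a (filter P xs) b \<le> w a x + walk w x (filter P xs) b"
    by (rule walk_le_detour_start) (use Cons.prems in auto)
  moreover have "walk w x (filter P xs) b \<le> walk w x xs b"
    using Cons by simp
  ultimately show ?case by auto
qed simp

text \<open>The combined round trip saves the visit to \<open>a\<close> between the two parts, going
  directly to the first vertex of \<open>ys\<close>.\<close>

lemma walk_concat_le:
  assumes "a \<in> V" "set xs \<subseteq> V" "set ys \<subseteq> V"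
  shows "walk w a (xs @ ys) a \<le> walk w a xs a + walk w a ys a"
proof (cases ys)
  case Nil
  then show ?thesis using assms zero by simp
next
  case (Cons y ys')
  then show ?thesis using assms walk_le_detour_end[of a a y xs] by (simp add: walk_append)
qed

lemma merge_tours:
  assumes "xs \<in> tours N A" "ys \<in> tours N B" "V = {0..N}"
  shows "\<exists>zs\<in>tours N (A \<union> B). tour_length w zs \<le> tour_length w xs + tour_length w ys"
proof -
  \<comment> \<open>Tours are cyclic and all visit the depot, so a rotation brings it to the front,
    where two tours can be joined.\<close>
  have depot_first: "\<exists>us. distinct (0 # us) \<and> set (0 # us) = set zs \<and> tour_length w zs = walk w 0 us 0"
    if zs: "zs \<in> tours N S" for zs S
  proof -
    have "0 \<in> set zs" using zs by (simp add: tours_def)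
    then obtain ps qs where z: "zs = ps @ 0 # qs" by (meson split_list)
    have "tour_length w zs = walk w 0 (qs @ ps) 0"
      using tour_length_rotate[of w ps "0 # qs"] by (simp add: z tour_length_Cons)
    moreover have "distinct (0 # qs @ ps)" "set (0 # qs @ ps) = set zs"
      using zs by (auto simp: tours_def z)
    ultimately show ?thesis by blast
  qed
  obtain us where us: "distinct (0 # us)" "set (0 # us) = set xs" "tour_length w xs = walk w 0 us 0"
    using depot_first[OF assms(1)] by blast
  obtain vs where vs: "distinct (0 # vs)" "set (0 # vs) = set ys" "tour_length w ys = walk w 0 vs 0"
    using depot_first[OF assms(2)] by blast
  have V: "set us \<subseteq> V" "set vs \<subseteq> V" "0 \<in> V"
  proof -
    have "set (0 # us) \<subseteq> V" "set (0 # vs) \<subseteq> V"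
      using assms unfolding us(2) vs(2) tours_def by simp_all
    then show "set us \<subseteq> V" "set vs \<subseteq> V" "0 \<in> V" by simp_all
  qed
  \<comment> \<open>A tour lists each vertex once, so the second round trip must omit what the first
    has visited.\<close>
  let ?zs = "0 # us @ filter (\<lambda>v. v \<notin> set us) vs"
  have "tour_length w ?zs \<le> walk w 0 us 0 + walk w 0 (filter (\<lambda>v. v \<notin> set us) vs) 0"
    unfolding tour_length_Cons by (rule walk_concat_le) (use V in auto)
  also have "\<dots> \<le> walk w 0 us 0 + walk w 0 vs 0"
    using walk_filter_le[of 0 0 vs] V by simp
  finally have "tour_length w ?zs \<le> tour_length w xs + tour_length w ys"
    using us vs by simp
  moreover have "set ?zs = set xs \<union> set ys"
    unfolding us(2)[symmetric] vs(2)[symmetric] by auto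
  then have "?zs \<in> tours N (A \<union> B)"
    using us(1) vs(1) assms unfolding tours_def mem_Collect_eq by (simp only:) auto
  ultimately show ?thesis by blast
qed

lemma tour_length_nonneg: "0 \<le> tour_length w xs"
  unfolding tour_length_def by (intro sum_nonneg) (simp add: nonneg)

end

text \<open>Distinctness bounds the length of a tour by the number of vertices; finiteness makes the
  \<open>Min\<close> in \<open>irp\<close> an attained lower bound.\<close>

lemma finite_tours: "finite (tours N S)"
proof -
  have "finite {xs. set xs \<subseteq> {0..N} \<and> length xs \<le> Suc N}"
    by (rule finite_lists_length_le) simp
  moreover have "length xs \<le> Suc N" if "xs \<in> tours N S" for xs
    using that card_mono[of "{0..N}" "set xs"] by (simp add: tours_def distinct_card)
  then have "tours N S \<subseteq> {xs. set xs \<subseteq> {0..N} \<and> length xs \<le> Suc N}"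
    by (auto simp: tours_def)
  ultimately show ?thesis by (rule finite_subset[rotated])
qed

lemma tours_nonempty: "S \<subseteq> {1..N} \<Longrightarrow> tours N S \<noteq> {}"
proof -
  assume "S \<subseteq> {1..N}"
  \<comment> \<open>The tour through all vertices serves every \<open>S\<close>.\<close>
  then have "[0..<Suc N] \<in> tours N S" by (auto simp: tours_def simp del: upt_Suc)
  then show ?thesis by blast
qed

lemma irp_monotone_subadditive:
  assumes "irp w I"
  shows "monotone_subadditive_cost I"
proof -
  let ?N = "num_elems I"
  interpret rat_metric "{0..?N}" w
    using assms by (intro rat_metric.intro) (simp add: irp_def)
  have cost: "order_cost I S = Min (tour_length w ` tours ?N S)" if "S \<subseteq> elements I" for S
    using assms that by (auto simp: irp_def)
  have ne: "tours ?N S \<noteq> {}" if "S \<subseteq> elements I" for S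
    using that by (intro tours_nonempty) (simp add: elements_def)
  have attained: "\<exists>xs\<in>tours ?N S. order_cost I S = tour_length w xs" if "S \<subseteq> elements I" for S
  proof -
    have "Min (tour_length w ` tours ?N S) \<in> tour_length w ` tours ?N S"
      using ne[OF that] finite_tours by (intro Min_in) auto
    then show ?thesis using cost[OF that] by auto
  qed
  have le: "order_cost I S \<le> tour_length w xs" if "S \<subseteq> elements I" "xs \<in> tours ?N S" for S xs
    using that cost finite_tours by simp
  show ?thesis
    unfolding monotone_subadditive_cost_def
  proof (intro conjI allI impI)
    fix A assume "A \<subseteq> elements I"
    then obtain xs where "order_cost I A = tour_length w xs" using attained by blast
    then show "0 \<le> order_cost I A" using tour_length_nonneg by simp
  next
    fix A B assume AB: "A \<subseteq> B \<and> B \<subseteq> elements I"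
    then obtain xs where xs: "xs \<in> tours ?N B" "order_cost I B = tour_length w xs"
      using attained by blast
    \<comment> \<open>Tours may visit further vertices, so a tour for \<open>B\<close> already is
      one for \<open>A\<close>.\<close>
    have "xs \<in> tours ?N A" using xs(1) AB by (auto simp: tours_def)
    then show "order_cost I A \<le> order_cost I B" using le[of A xs] AB xs(2) by auto
  next
    fix A B assume AB: "A \<subseteq> elements I \<and> B \<subseteq> elements I"
    obtain xs where xs: "xs \<in> tours ?N A" "order_cost I A = tour_length w xs"
      using attained AB by blast
    obtain ys where ys: "ys \<in> tours ?N B" "order_cost I B = tour_length w ys"
      using attained AB by blast
    obtain zs where "zs \<in> tours ?N (A \<union> B)" "tour_length w zs \<le> tour_length w xs + tour_length w ys"
      using merge_tours[OF xs(1) ys(1) refl] by blast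
    then show "order_cost I (A \<union> B) \<le> order_cost I A + order_cost I B"
      using le[of "A \<union> B" zs] AB xs(2) ys(2) by simp
  qed
qed

section \<open>Running time of programs\<close>

lemma abs_less_two_power: "\<bar>k\<bar> < 2 ^ floorlog 2 (nat \<bar>k\<bar>)"
proof -
  have "nat \<bar>k\<bar> < 2 ^ floorlog 2 (nat \<bar>k\<bar>)" by (rule floorlog_leD) auto
  then show ?thesis by (simp add: nat_less_iff)
qed

lemma vsize_VInt_le: "\<bar>k\<bar> < 2 ^ n \<Longrightarrow> vsize (VInt k) \<le> Suc n"
  by (simp add: floorlog_le_iff nat_less_iff)

lemma vsize_VInt_mono: "\<bar>k\<bar> \<le> \<bar>l\<bar> \<Longrightarrow> vsize (VInt k) \<le> vsize (VInt l)"
  by (simp add: floorlog_mono nat_mono)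

lemma vsize_pos: "1 \<le> vsize v"
  by (cases v) auto

text \<open>The sum of the lengths is used in place of their maximum so that all arithmetic
  operations, multiplication included, obey one rule. The constants 1 in the two sizes leave room
  for the carry.\<close>

lemma vsize_add: "vsize (VInt (a + b)) \<le> vsize (VInt a) + vsize (VInt b)"
proof -
  let ?x = "floorlog 2 (nat \<bar>a\<bar>)" and ?y = "floorlog 2 (nat \<bar>b\<bar>)"
  have "(2 :: int) ^ ?x \<le> 2 ^ (?x + ?y)" "(2 :: int) ^ ?y \<le> 2 ^ (?x + ?y)"
    by (simp_all add: power_increasing)
  then have "\<bar>a + b\<bar> < 2 ^ Suc (?x + ?y)"
    using abs_less_two_power[of a] abs_less_two_power[of b] abs_triangle_ineq[of a b]
    unfolding power_Suc by linarith
  then show ?thesis using vsize_VInt_le by fastforce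
qed

lemma vsize_diff: "vsize (VInt (a - b)) \<le> vsize (VInt a) + vsize (VInt b)"
  using vsize_add[of a "- b"] by simp

lemma vsize_mult: "vsize (VInt (a * b)) \<le> vsize (VInt a) + vsize (VInt b)"
proof -
  let ?x = "floorlog 2 (nat \<bar>a\<bar>)" and ?y = "floorlog 2 (nat \<bar>b\<bar>)"
  have "\<bar>a * b\<bar> < 2 ^ (?x + ?y)"
    unfolding abs_mult power_add
    by (rule mult_strict_mono') (simp_all add: abs_less_two_power)
  then show ?thesis using vsize_VInt_le by fastforce
qed

text \<open>For positive \<open>b\<close>, compare with division by 1; rounding towards minus
  infinity never leads past a negative \<open>a\<close>. A negative divisor is reduced to this by
  negating both arguments, and division by zero gives 0.\<close>

lemma abs_div_le: "\<bar>a div b\<bar> \<le> \<bar>a :: int\<bar>"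
proof -
  have pos: "\<bar>a div b\<bar> \<le> \<bar>a\<bar>" if "0 < b" for a b :: int
  proof (cases "0 \<le> a")
    case True
    then show ?thesis
      using that zdiv_mono2[of a 1 b] pos_imp_zdiv_nonneg_iff[of b a] by simp
  next
    case False
    then show ?thesis
      using that zdiv_mono2_neg[of a 1 b] pos_imp_zdiv_neg_iff[of b a] by simp
  qed
  consider "b = 0" | "0 < b" | "0 < - b" by linarith
  then show ?thesis
  proof cases
    case 3
    then show ?thesis using pos[of "- b" "- a"] by simp
  qed (use pos in auto)
qed

lemma vsize_div: "vsize (VInt (a div b)) \<le> vsize (VInt a) + vsize (VInt b)"
  using vsize_VInt_mono[OF abs_div_le[of a b]] by linarith

lemma vsize_mod: "vsize (VInt (a mod b)) \<le> vsize (VInt a) + vsize (VInt b)"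
\<comment> \<open>\<open>a mod 0 = a\<close> is covered by the size of \<open>a\<close>, every other
  remainder by that of \<open>b\<close>.\<close>
proof (cases "b = 0")
  case False
  then have "\<bar>a mod b\<bar> \<le> \<bar>b\<bar>" using abs_mod_less[of b a] by simp
  then show ?thesis using vsize_VInt_mono[of "a mod b" b] by linarith
qed simp

lemma vsize_int_of: "vsize (VInt (int_of v)) \<le> vsize v"
  by (cases v) (auto simp: floorlog_def)

lemma vsize_left_of: "vsize (left_of v) \<le> vsize v"
  by (cases v) (auto simp: floorlog_def)

lemma vsize_right_of: "vsize (right_of v) \<le> vsize v"
  by (cases v) (auto simp: floorlog_def)

lemma vsize_vbool: "vsize (vbool b) \<le> 2"
  using vsize_VInt_le[of 1 1] by (simp add: vbool_def floorlog_def)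

section \<open>Size of states and cost of expressions\<close>

definition bounded_state :: "nat \<Rightarrow> state \<Rightarrow> bool" where
  "bounded_state B \<sigma> \<longleftrightarrow> (\<forall>x. vsize (\<sigma> x) \<le> B)"

lemma bounded_stateD: "bounded_state B \<sigma> \<Longrightarrow> vsize (\<sigma> x) \<le> B"
  by (simp add: bounded_state_def)

lemma bounded_state_pos: "bounded_state B \<sigma> \<Longrightarrow> 1 \<le> B"
  using bounded_stateD vsize_pos order_trans by blast

lemma bounded_state_mono: "bounded_state B \<sigma> \<Longrightarrow> B \<le> C \<Longrightarrow> bounded_state C \<sigma>"
  using order_trans by (auto simp: bounded_state_def)

lemma bounded_state_upd:
  "bounded_state B \<sigma> \<Longrightarrow> vsize v \<le> B \<Longrightarrow> bounded_state B (\<sigma>(x := v))"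
  by (simp add: bounded_state_def)

text \<open>Results of expressions and the cost of evaluating them are linear in the size of the
  state; \<open>esize\<close> and \<open>ecost\<close> are the factors.\<close>

fun esize :: "expr \<Rightarrow> nat" where
  "esize (EVar x) = 1"
| "esize (EInt k) = vsize (VInt k)"
| "esize (EPair a b) = 1 + esize a + esize b"
| "esize (ELeft a) = esize a"
| "esize (ERight a) = esize a"
| "esize (EIsPair a) = 2"
| "esize (EAdd a b) = esize a + esize b"
| "esize (ESub a b) = esize a + esize b"
| "esize (EMul a b) = esize a + esize b"
| "esize (EDiv a b) = esize a + esize b"
| "esize (EMod a b) = esize a + esize b"
| "esize (ELess a b) = 2"
| "esize (EEq a b) = 2"

fun ecost :: "expr \<Rightarrow> nat" where
  "ecost (EVar x) = esize (EVar x)"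
| "ecost (EInt k) = esize (EInt k)"
| "ecost (EPair a b) = ecost a + ecost b + esize (EPair a b)"
| "ecost (ELeft a) = ecost a + esize (ELeft a)"
| "ecost (ERight a) = ecost a + esize (ERight a)"
| "ecost (EIsPair a) = ecost a + esize (EIsPair a)"
| "ecost (EAdd a b) = ecost a + ecost b + esize (EAdd a b)"
| "ecost (ESub a b) = ecost a + ecost b + esize (ESub a b)"
| "ecost (EMul a b) = ecost a + ecost b + esize (EMul a b)"
| "ecost (EDiv a b) = ecost a + ecost b + esize (EDiv a b)"
| "ecost (EMod a b) = ecost a + ecost b + esize (EMod a b)"
| "ecost (ELess a b) = ecost a + ecost b + esize (ELess a b)"
| "ecost (EEq a b) = ecost a + ecost b + esize (EEq a b)"

text \<open>Even a product only adds lengths, and an expression contains no iteration, so the size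
  of its value stays linear in \<open>B\<close>.\<close>

lemma vsize_eval_le:
  assumes "bounded_state B \<sigma>"
  shows "vsize (eval_expr e \<sigma>) \<le> esize e * B"
proof -
  note B = bounded_state_pos[OF assms]
  have arith: "vsize (VInt (f (int_of u) (int_of v))) \<le> (k + l) * B"
    if "vsize u \<le> k * B" "vsize v \<le> l * B"
      and "\<And>a b. vsize (VInt (f a b)) \<le> vsize (VInt a) + vsize (VInt b)" for f u v k l
    using that vsize_int_of[of u] vsize_int_of[of v] unfolding add_mult_distrib
    by (meson add_mono order_trans)
  have test: "vsize (vbool b) \<le> 2 * B" for b
    using vsize_vbool[of b] B by linarith
  show ?thesis
  proof (induction e)
    case (EVar x)
    then show ?case using bounded_stateD[OF assms] by simp
  next
    case (EInt k)
    then show ?case using B by (cases B) auto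
  next
    case (EPair a b)
    then show ?case using B by (simp add: add_mult_distrib)
  next
    case (ELeft a)
    then show ?case using vsize_left_of order_trans by fastforce
  next
    case (ERight a)
    then show ?case using vsize_right_of order_trans by fastforce
  next
    case (EAdd a b)
    then show ?case using arith[of _ _ _ _ "(+)"] vsize_add by simp
  next
    case (ESub a b)
    then show ?case using arith[of _ _ _ _ "(-)"] vsize_diff by simp
  next
    case (EMul a b)
    then show ?case using arith[of _ _ _ _ "(*)"] vsize_mult by simp
  next
    case (EDiv a b)
    then show ?case using arith[of _ _ _ _ "(div)"] vsize_div by simp
  next
    case (EMod a b)
    then show ?case using arith[of _ _ _ _ "(mod)"] vsize_mod by simp
  qed (simp_all only: eval_expr.simps esize.simps test)
qed

lemma expr_cost_le:
  assumes "bounded_state B \<sigma>"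
  shows "expr_cost e \<sigma> \<le> ecost e * B"
proof (induction e)
qed (use vsize_eval_le[OF assms] in
  \<open>auto simp: add_mult_distrib simp del: eval_expr.simps esize.simps intro!: add_mono\<close>)

section \<open>Composition of time bounds\<close>

text \<open>Exact times depend on the branches taken and the sizes met; upper bounds compose without
  tracking these.\<close>

definition runs :: "(val \<Rightarrow> val) \<Rightarrow> com \<Rightarrow> state \<Rightarrow> nat \<Rightarrow> state \<Rightarrow> bool" where
  "runs ora P \<sigma> n \<sigma>' \<longleftrightarrow> (\<exists>m\<le>n. exec ora P \<sigma> m \<sigma>')"

lemma runs_mono: "runs ora P \<sigma> m \<sigma>' \<Longrightarrow> m \<le> n \<Longrightarrow> runs ora P \<sigma> n \<sigma>'"
  unfolding runs_def using order_trans by blast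

lemma runs_Seq:
  assumes "runs ora P \<sigma> m \<sigma>'" "runs ora Q \<sigma>' n \<sigma>''"
  shows "runs ora (Seq P Q) \<sigma> (1 + m + n) \<sigma>''"
proof -
  obtain m' n' where "m' \<le> m" "n' \<le> n" "exec ora P \<sigma> m' \<sigma>'" "exec ora Q \<sigma>' n' \<sigma>''"
    using assms by (auto simp: runs_def)
  then have "exec ora (Seq P Q) \<sigma> (1 + m' + n') \<sigma>''" "1 + m' + n' \<le> 1 + m + n"
    by (blast intro: exec_Seq, linarith)
  then show ?thesis unfolding runs_def by blast
qed

lemma runs_Cond:
  assumes "holds e \<sigma> \<Longrightarrow> runs ora P \<sigma> n \<sigma>'" "\<not> holds e \<sigma> \<Longrightarrow> runs ora Q \<sigma> n \<sigma>'"
    and "expr_cost e \<sigma> \<le> k"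
  shows "runs ora (Cond e P Q) \<sigma> (1 + k + n) \<sigma>'"
proof -
  obtain m where "m \<le> n" "exec ora (Cond e P Q) \<sigma> (1 + expr_cost e \<sigma> + m) \<sigma>'"
    using assms(1,2) unfolding runs_def by (meson exec_CondT exec_CondF)
  moreover have "1 + expr_cost e \<sigma> + m \<le> 1 + k + n" using assms(3) \<open>m \<le> n\<close> by linarith
  ultimately show ?thesis unfolding runs_def by blast
qed

text \<open>\<open>J k\<close> is the loop invariant with \<open>k\<close> iterations to go.\<close>

lemma runs_While:
  assumes "J k \<sigma>"
    and cost: "\<And>k \<sigma>. J k \<sigma> \<Longrightarrow> 1 + expr_cost e \<sigma> \<le> b"
    and step: "\<And>k \<sigma>. J (Suc k) \<sigma> \<Longrightarrow> holds e \<sigma> \<and> (\<exists>\<sigma>'. runs ora P \<sigma> a \<sigma>' \<and> J k \<sigma>')"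
    and stop: "\<And>\<sigma>. J 0 \<sigma> \<Longrightarrow> \<not> holds e \<sigma>"
  shows "\<exists>\<sigma>'. runs ora (While e P) \<sigma> (Suc k * (a + b)) \<sigma>' \<and> J 0 \<sigma>'"
  using assms(1)
proof (induction k arbitrary: \<sigma>)
  case 0
  have "exec ora (While e P) \<sigma> (1 + expr_cost e \<sigma>) \<sigma>" by (rule exec_WhileF[OF stop[OF 0]])
  \<comment> \<open>The final failing test is paid for like a full round, hence the factor
    \<open>Suc k\<close>.\<close>
  moreover have "1 + expr_cost e \<sigma> \<le> Suc 0 * (a + b)" using cost[OF 0] by simp
  ultimately show ?case using 0 unfolding runs_def by blast
next
  case (Suc k)
  obtain \<sigma>' m where h: "holds e \<sigma>" and m: "m \<le> a" "exec ora P \<sigma> m \<sigma>'" and "J k \<sigma>'"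
    using step[OF Suc.prems] by (auto simp: runs_def)
  obtain \<sigma>'' n where n: "n \<le> Suc k * (a + b)" "exec ora (While e P) \<sigma>' n \<sigma>''" and J: "J 0 \<sigma>''"
    using Suc.IH[OF \<open>J k \<sigma>'\<close>] by (auto simp: runs_def)
  have "exec ora (While e P) \<sigma> (1 + expr_cost e \<sigma> + m + n) \<sigma>''"
    by (rule exec_WhileT[OF h m(2) n(2)])
  moreover have "1 + expr_cost e \<sigma> + m + n \<le> Suc (Suc k) * (a + b)"
    using cost[OF Suc.prems] m(1) n(1) by simp
  ultimately show ?case using J unfolding runs_def by blast
qed

section \<open>Straight-line programs\<close>

text \<open>Queries are excluded along with loops, since the size of an answer is not controlled by
  the state. The bounds obtained hold for every oracle.\<close>

fun straight_line :: "com \<Rightarrow> bool" where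
  "straight_line Skip = True"
| "straight_line (Assign x e) = True"
| "straight_line (Query x e) = False"
| "straight_line (Seq P Q) = (straight_line P \<and> straight_line Q)"
| "straight_line (Cond e P Q) = (straight_line P \<and> straight_line Q)"
| "straight_line (While e P) = False"

text \<open>The last equation is genuine for \<open>Skip\<close> and a dummy value for queries and
  loops.\<close>

fun effect :: "com \<Rightarrow> state \<Rightarrow> state" where
  "effect (Assign x e) \<sigma> = \<sigma>(x := eval_expr e \<sigma>)"
| "effect (Seq P Q) \<sigma> = effect Q (effect P \<sigma>)"
| "effect (Cond e P Q) \<sigma> = (if holds e \<sigma> then effect P \<sigma> else effect Q \<sigma>)"
| "effect P \<sigma> = \<sigma>"

fun growth :: "com \<Rightarrow> nat" where
  "growth (Assign x e) = 1 + esize e"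
| "growth (Seq P Q) = growth P * growth Q"
| "growth (Cond e P Q) = growth P + growth Q"
| "growth P = 1"

text \<open>The second part of a sequence starts from a state already enlarged by
  \<open>growth P\<close>, hence the product. For branches, the sum stands in for the
  maximum.\<close>

fun cost_factor :: "com \<Rightarrow> nat" where
  "cost_factor (Assign x e) = 1 + ecost e"
| "cost_factor (Seq P Q) = 1 + cost_factor P + growth P * cost_factor Q"
| "cost_factor (Cond e P Q) = 1 + ecost e + (cost_factor P + cost_factor Q)"
| "cost_factor P = 1"

lemma runs_straight_line_growth:
  assumes "straight_line P" "bounded_state B \<sigma>"
  shows "runs ora P \<sigma> (cost_factor P * B) (effect P \<sigma>) \<and> bounded_state (growth P * B) (effect P \<sigma>)"
  using assms
proof (induction P arbitrary: B \<sigma>)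
  case Skip
  then have "1 \<le> B" by (auto dest: bounded_state_pos)
  then show ?case using Skip exec_Skip[of ora \<sigma>] by (auto simp: runs_def)
next
  case (Assign x e)
  then have B: "1 \<le> B" by (auto dest: bounded_state_pos)
  have "1 + expr_cost e \<sigma> \<le> cost_factor (Assign x e) * B"
    using expr_cost_le[OF Assign.prems(2), of e] B by simp
  moreover have "bounded_state (growth (Assign x e) * B) (\<sigma>(x := eval_expr e \<sigma>))"
  proof (rule bounded_state_upd)
    show "bounded_state (growth (Assign x e) * B) \<sigma>"
      by (rule bounded_state_mono[OF Assign.prems(2)]) simp
    show "vsize (eval_expr e \<sigma>) \<le> growth (Assign x e) * B"
      using vsize_eval_le[OF Assign.prems(2), of e] by simp
  qed
  ultimately show ?case
    using exec_Assign[of ora x e \<sigma>] unfolding runs_def effect.simps by blast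
next
  case (Seq P Q)
  have P: "runs ora P \<sigma> (cost_factor P * B) (effect P \<sigma>)"
    "bounded_state (growth P * B) (effect P \<sigma>)"
    using Seq by auto
  have Q: "runs ora Q (effect P \<sigma>) (cost_factor Q * (growth P * B)) (effect Q (effect P \<sigma>))"
    "bounded_state (growth Q * (growth P * B)) (effect Q (effect P \<sigma>))"
    using Seq P(2) by auto
  have "1 \<le> B" using Seq.prems bounded_state_pos by blast
  then have "runs ora (Seq P Q) \<sigma> (cost_factor (Seq P Q) * B) (effect Q (effect P \<sigma>))"
    by (intro runs_mono[OF runs_Seq[OF P(1) Q(1)]]) (simp add: algebra_simps)
  then show ?case using Q(2) by (simp add: mult.commute mult.left_commute)
next
  case (Cond e P Q)
  let ?\<sigma>' = "effect (Cond e P Q) \<sigma>" and ?n = "(cost_factor P + cost_factor Q) * B"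
  have P: "runs ora P \<sigma> ?n (effect P \<sigma>)" "bounded_state ((growth P + growth Q) * B) (effect P \<sigma>)"
    using Cond.IH(1)[of B \<sigma>] Cond.prems
    by (auto elim!: runs_mono bounded_state_mono simp: add_mult_distrib)
  have Q: "runs ora Q \<sigma> ?n (effect Q \<sigma>)" "bounded_state ((growth P + growth Q) * B) (effect Q \<sigma>)"
    using Cond.IH(2)[of B \<sigma>] Cond.prems
    by (auto elim!: runs_mono bounded_state_mono simp: add_mult_distrib)
  have "1 \<le> B" using Cond.prems bounded_state_pos by blast
  moreover have "runs ora (Cond e P Q) \<sigma> (1 + ecost e * B + ?n) ?\<sigma>'"
    by (rule runs_Cond) (use P Q expr_cost_le[OF Cond.prems(2)] in auto)
  ultimately have "runs ora (Cond e P Q) \<sigma> (cost_factor (Cond e P Q) * B) ?\<sigma>'"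
    by (elim runs_mono) (simp add: algebra_simps)
  then show ?case using P Q by simp
qed simp_all

text \<open>The state bound is dropped because its growth factor would compound over the iterations
  of a loop; the loop proofs re-establish the fixed bound from the actual values.\<close>

lemmas runs_straight_line = runs_straight_line_growth[THEN conjunct1]

section \<open>A program for the block schedule\<close>

lemma enc_list_simps [simp]:
  "enc_list [] = VInt 0" "enc_list (v # vs) = VPair v (enc_list vs)"
  by (simp_all add: enc_list_def)

text \<open>An accumulator is no larger than the list it ends up in, so bounding the final list
  bounds all intermediate ones.\<close>

lemma vsize_foldr_ge: "vsize acc \<le> vsize (foldr VPair vs acc)"
  by (induction vs) auto

lemma vsize_foldr_le:
  "\<forall>v\<in>set vs. vsize v \<le> b \<Longrightarrow> vsize (foldr VPair vs acc) \<le> vsize acc + length vs * Suc b"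
  by (induction vs) auto

lemma length_le_vsize: "length vs \<le> vsize (enc_list vs)"
  by (induction vs) auto

lemma vsize_member_le: "v \<in> set vs \<Longrightarrow> vsize v \<le> vsize (enc_list vs)"
  by (induction vs) auto

lemma dec_nth_enc_list: "k < length vs \<Longrightarrow> dec_nth (enc_list vs) k = vs ! k"
proof (induction vs arbitrary: k)
  case (Cons v vs)
  then show ?case
    by (cases k) (auto simp: dec_nth_def funpow_Suc_right simp del: funpow.simps)
qed simp

lemma vsize_enc_nat_mono: "m \<le> n \<Longrightarrow> vsize (enc_nat m) \<le> vsize (enc_nat n)"
  unfolding enc_nat_def by (rule vsize_VInt_mono) simp

text \<open>A crude linear bound is enough: it is applied to indices and counts that do not exceed
  the input size.\<close>

lemma vsize_enc_nat_le: "vsize (enc_nat n) \<le> Suc n"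
proof -
  have "int n < int (2 ^ n)" by (simp only: of_nat_less_iff less_exp)
  then show ?thesis unfolding enc_nat_def by (intro vsize_VInt_le) simp
qed

section \<open>Functional counterparts of the scanning loops\<close>

text \<open>\<open>t\<close> counts the entries already read, so the head of the list belongs to
  period \<open>Suc t\<close>. An element is prepended once per matching demand;
  \<open>dec_set\<close> removes the repetitions.\<close>

fun scan_row_result :: "nat \<Rightarrow> nat \<Rightarrow> nat \<Rightarrow> nat \<Rightarrow> rat list \<Rightarrow> val \<Rightarrow> val" where
  "scan_row_result K s i t [] acc = acc"
| "scan_row_result K s i t (q # qs) acc = scan_row_result K s i (Suc t) qs
     (if 0 < q \<and> block_start K (Suc t) = s then VPair (enc_nat i) acc else acc)"

fun scan_matrix_result :: "nat \<Rightarrow> nat \<Rightarrow> nat \<Rightarrow> rat list list \<Rightarrow> val \<Rightarrow> val" where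
  "scan_matrix_result K s i [] acc = acc"
| "scan_matrix_result K s i (r # rs) acc =
     scan_matrix_result K s (Suc i) rs (scan_row_result K s (Suc i) 0 r acc)"

lemma vsize_scan_row_ge: "vsize acc \<le> vsize (scan_row_result K s i t qs acc)"
proof (induction qs arbitrary: t acc)
  case (Cons q qs)
  have "vsize acc \<le> vsize (if 0 < q \<and> block_start K (Suc t) = s then VPair (enc_nat i) acc else acc)"
    by simp
  also have "\<dots> \<le> vsize (scan_row_result K s i t (q # qs) acc)"
    unfolding scan_row_result.simps by (rule Cons)
  finally show ?case .
qed simp

lemma vsize_scan_row_le:
  "vsize (scan_row_result K s i t qs acc) \<le> vsize acc + length qs * (i + 2)"
proof (induction qs arbitrary: t acc)
  case (Cons q qs)
  let ?acc = "if 0 < q \<and> block_start K (Suc t) = s then VPair (enc_nat i) acc else acc"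
  have "vsize (scan_row_result K s i t (q # qs) acc) \<le> vsize ?acc + length qs * (i + 2)"
    unfolding scan_row_result.simps by (rule Cons)
  moreover have "vsize ?acc \<le> vsize acc + (i + 2)"
    using vsize_enc_nat_le[of i] by simp
  ultimately show ?case by simp
qed simp

lemma vsize_scan_matrix_ge: "vsize acc \<le> vsize (scan_matrix_result K s i rs acc)"
  by (induction rs arbitrary: i acc) (auto intro: order_trans[OF vsize_scan_row_ge])

lemma vsize_scan_matrix_le:
  assumes "\<forall>r\<in>set rs. length r = T" "i + length rs \<le> N"
  shows "vsize (scan_matrix_result K s i rs acc) \<le> vsize acc + length rs * (T * (N + 2))"
  using assms
proof (induction rs arbitrary: i acc)
  case (Cons r rs)
  let ?acc = "scan_row_result K s (Suc i) 0 r acc"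
  have "vsize (scan_matrix_result K s i (r # rs) acc) \<le> vsize ?acc + length rs * (T * (N + 2))"
    unfolding scan_matrix_result.simps by (rule Cons.IH) (use Cons.prems in auto)
  moreover have "T * (Suc i + 2) \<le> T * (N + 2)"
    using Cons.prems(2) by (intro mult_le_mono2) simp
  then have "vsize ?acc \<le> vsize acc + T * (N + 2)"
    using vsize_scan_row_le[of K s "Suc i" 0 r acc] Cons.prems(1) by simp
  ultimately show ?case by simp
qed simp

lemma dec_set_scan_row:
  "j \<in> dec_set (scan_row_result K s i t qs acc) \<longleftrightarrow>
     j \<in> dec_set acc \<or> j = i \<and> (\<exists>k<length qs. 0 < qs ! k \<and> block_start K (Suc (t + k)) = s)"
  by (induction qs arbitrary: t acc) (auto simp: Ex_less_Suc2 enc_nat_def)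

lemma dec_set_scan_matrix:
  "j \<in> dec_set (scan_matrix_result K s i rs acc) \<longleftrightarrow>
     j \<in> dec_set acc \<or> (\<exists>m<length rs. j = Suc (i + m) \<and>
       (\<exists>k<length (rs ! m). 0 < rs ! m ! k \<and> block_start K (Suc k) = s))"
  by (induction rs arbitrary: i acc) (auto simp: Ex_less_Suc2 dec_set_scan_row)

text \<open>
  Variable \<open>1\<close> holds the block length, \<open>2\<close> the demand matrix, \<open>3\<close> the current period \<open>s\<close>,
  \<open>4\<close> and \<open>5\<close> the order sets and the serving periods from \<open>s + 1\<close> on, \<open>6\<close> the order set of
  period \<open>s\<close>, \<open>7\<close> and \<open>10\<close> the number of rows and entries scanned, \<open>8\<close> and \<open>9\<close> the rest of the
  matrix and of its current row, and \<open>11\<close> the matrix of serving periods.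
\<close>

definition block_start_expr :: "nat \<Rightarrow> expr" where
  "block_start_expr x = ESub (EVar x) (EMod (ESub (EVar x) (EInt 1)) (EVar 1))"

text \<open>The product of two truth values is their conjunction, and the sign of a demand is read
  off from its numerator.\<close>

definition row_step :: com where
  "row_step =
     Seq (Assign 10 (EAdd (EVar 10) (EInt 1)))
    (Seq (Cond (EMul (ELess (EInt 0) (ELeft (ELeft (EVar 9)))) (EEq (block_start_expr 10) (EVar 3)))
            (Assign 6 (EPair (EVar 7) (EVar 6))) Skip)
         (Assign 9 (ERight (EVar 9))))"

definition scan_row :: com where
  "scan_row = While (EIsPair (EVar 9)) row_step"

definition enter_row :: com where
  "enter_row =
     Seq (Assign 7 (EAdd (EVar 7) (EInt 1))) (Seq (Assign 9 (ELeft (EVar 8))) (Assign 10 (EInt 0)))"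

definition leave_row :: com where
  "leave_row = Assign 8 (ERight (EVar 8))"

definition scan_matrix :: com where
  "scan_matrix = While (EIsPair (EVar 8)) (Seq enter_row (Seq scan_row leave_row))"

definition enter_period :: com where
  "enter_period = Seq (Assign 6 (EInt 0)) (Seq (Assign 7 (EInt 0)) (Assign 8 (EVar 2)))"

definition leave_period :: com where
  "leave_period =
     Seq (Assign 4 (EPair (EVar 6) (EVar 4)))
    (Seq (Assign 5 (EPair (block_start_expr 3) (EVar 5))) (Assign 3 (ESub (EVar 3) (EInt 1))))"

text \<open>Periods are visited downwards because \<open>EPair\<close> prepends; both lists come out
  in ascending order.\<close>

definition scan_periods :: com where
  "scan_periods = While (ELess (EInt 0) (EVar 3)) (Seq enter_period (Seq scan_matrix leave_period))"

text \<open>The serving period of \<open>(i, t)\<close> depends on \<open>t\<close> alone, so one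
  row computed once is repeated for all elements.\<close>

definition copy_row :: com where
  "copy_row = Seq (Assign 11 (EPair (EVar 5) (EVar 11))) (Assign 2 (ERight (EVar 2)))"

definition copy_rows :: com where
  "copy_rows = While (EIsPair (EVar 2)) copy_row"

text \<open>Integer division of numerator by denominator yields \<open>\<lfloor>c\<rfloor>\<close>.
  The factor \<open>EIsPair (EVar 2)\<close> sets the period counter to 0 if the matrix has no
  rows.\<close>

definition read_input :: com where
  "read_input =
     Seq (Assign 1 (let c = ELeft (ERight (ERight (EVar 0))) in EAdd (EDiv (ELeft c) (ERight c)) (EInt 1)))
    (Seq (Assign 2 (ELeft (ERight (ERight (ERight (EVar 0))))))
         (Assign 3 (EMul (ELeft (ERight (EVar 0))) (EIsPair (EVar 2)))))"

definition write_output :: com where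
  "write_output = Assign 0 (EPair (EVar 4) (EVar 11))"

definition block_program :: com where
  "block_program = Seq read_input (Seq scan_periods (Seq copy_rows write_output))"

section \<open>Loop invariants and running times\<close>

lemma vbool_simps [simp]:
  "vbool b = VInt 0 \<longleftrightarrow> \<not> b" "int_of (vbool b) = of_bool b" "vbool True = VInt 1" "vbool False = VInt 0"
  by (simp_all add: vbool_def)

text \<open>The truncated subtraction in \<open>block_start\<close> agrees with the integer
  subtraction of the machine because the remainder never exceeds \<open>t\<close>.\<close>

lemma block_start_int: "int (Suc t) - int t mod int K = int (block_start K (Suc t))"
proof -
  have "t mod K \<le> Suc t" by (rule le_SucI) (rule mod_less_eq_dividend)
  then show ?thesis by (simp add: block_start_def of_nat_diff zmod_int)
qed

lemma eval_block_start_expr: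
  assumes "\<sigma> 1 = enc_nat K" "\<sigma> x = enc_nat (Suc t)"
  shows "eval_expr (block_start_expr x) \<sigma> = enc_nat (block_start K (Suc t))"
  using assms block_start_int[of t K] by (simp add: block_start_expr_def enc_nat_def)

lemma quotient_of_pos_iff: "0 < fst (quotient_of q) \<longleftrightarrow> 0 < q"
proof -
  have "q = of_int (fst (quotient_of q)) / of_int (snd (quotient_of q))"
    by (rule quotient_of_div) simp
  moreover have "0 < snd (quotient_of q)" by (rule quotient_of_denom_pos')
  ultimately show ?thesis by (metis of_int_0_less_iff zero_less_divide_iff less_asym)
qed

lemma enc_rat_simps [simp]:
  "left_of (enc_rat q) = VInt (fst (quotient_of q))" "right_of (enc_rat q) = VInt (snd (quotient_of q))"
  by (simp_all add: enc_rat_def)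

abbreviation enc_row :: "rat list \<Rightarrow> val" where
  "enc_row qs \<equiv> enc_list (map enc_rat qs)"

lemma effect_row_step:
  assumes "\<sigma> 1 = enc_nat K" "\<sigma> 3 = enc_nat s" "\<sigma> 7 = enc_nat i" "\<sigma> 10 = enc_nat t"
    "\<sigma> 9 = enc_row (q # qs)"
  shows "effect row_step \<sigma> = \<sigma>(10 := enc_nat (Suc t),
    6 := (if 0 < q \<and> block_start K (Suc t) = s then VPair (enc_nat i) (\<sigma> 6) else \<sigma> 6),
    9 := enc_row qs)"
proof -
  let ?\<sigma> = "\<sigma>(10 := enc_nat (Suc t))"
  have 1: "effect (Assign 10 (EAdd (EVar 10) (EInt 1))) \<sigma> = ?\<sigma>"
    using assms(4) by (simp add: enc_nat_def add.commute)
  have "eval_expr (block_start_expr 10) ?\<sigma> = enc_nat (block_start K (Suc t))"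
    by (rule eval_block_start_expr) (use assms in auto)
  then have "holds (EMul (ELess (EInt 0) (ELeft (ELeft (EVar 9)))) (EEq (block_start_expr 10) (EVar 3))) ?\<sigma>
      \<longleftrightarrow> 0 < q \<and> block_start K (Suc t) = s"
    using assms quotient_of_pos_iff[of q] by (auto simp: enc_nat_def)
  then show ?thesis
    unfolding row_step_def effect.simps(2) 1 using assms by (auto simp: fun_eq_iff)
qed

definition scan_row_factor :: nat where
  "scan_row_factor = cost_factor row_step + 1 + ecost (EIsPair (EVar 9))"

lemma guard_cost:
  assumes "bounded_state B \<sigma>"
  shows "1 + expr_cost e \<sigma> \<le> (1 + ecost e) * B"
  using expr_cost_le[OF assms, of e] bounded_state_pos[OF assms] by simp

lemma runs_scan_row:
  assumes bd: "bounded_state B \<sigma>"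
    and \<sigma>: "\<sigma> 1 = enc_nat K" "\<sigma> 3 = enc_nat s" "\<sigma> 7 = enc_nat i" "\<sigma> 10 = enc_nat t" "\<sigma> 9 = enc_row qs"
    and end_le: "vsize (enc_nat (t + length qs)) \<le> B"
    and res_le: "vsize (scan_row_result K s i t qs (\<sigma> 6)) \<le> B"
  shows "\<exists>\<sigma>'. runs ora scan_row \<sigma> (Suc (length qs) * (scan_row_factor * B)) \<sigma>' \<and> bounded_state B \<sigma>' \<and>
    \<sigma>' 6 = scan_row_result K s i t qs (\<sigma> 6) \<and> (\<forall>x. x \<notin> {6, 9, 10} \<longrightarrow> \<sigma>' x = \<sigma> x)"
proof -
  \<comment> \<open>The invariant says that continuing from here yields the overall result. The
    current accumulator is then no larger than that result, so \<open>res_le\<close> limits it in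
    every iteration.\<close>
  define J where "J k \<tau> \<longleftrightarrow> bounded_state B \<tau> \<and> (\<forall>x. x \<notin> {6, 9, 10} \<longrightarrow> \<tau> x = \<sigma> x) \<and>
    (\<exists>qs' t'. k = length qs' \<and> \<tau> 9 = enc_row qs' \<and> \<tau> 10 = enc_nat t' \<and> t' + k = t + length qs \<and>
      scan_row_result K s i t' qs' (\<tau> 6) = scan_row_result K s i t qs (\<sigma> 6))" for k \<tau>
  have "\<exists>\<sigma>'. runs ora scan_row \<sigma>
      (Suc (length qs) * (cost_factor row_step * B + (1 + ecost (EIsPair (EVar 9))) * B)) \<sigma>' \<and> J 0 \<sigma>'"
    unfolding scan_row_def
  proof (rule runs_While)
    show "J (length qs) \<sigma>" unfolding J_def using bd \<sigma> by blast
    show "1 + expr_cost (EIsPair (EVar 9)) \<tau> \<le> (1 + ecost (EIsPair (EVar 9))) * B" if "J k \<tau>" for k \<tau>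
      using that by (intro guard_cost) (simp add: J_def)
    show "\<not> holds (EIsPair (EVar 9)) \<tau>" if "J 0 \<tau>" for \<tau>
      using that by (auto simp: J_def)
    fix k \<tau> assume J: "J (Suc k) \<tau>"
    then obtain q qs' t' where b: "bounded_state B \<tau>" and same: "\<forall>x. x \<notin> {6, 9, 10} \<longrightarrow> \<tau> x = \<sigma> x"
      and k: "k = length qs'" and \<tau>: "\<tau> 9 = enc_row (q # qs')" "\<tau> 10 = enc_nat t'"
      and e: "Suc t' + k = t + length qs"
      and res: "scan_row_result K s i t' (q # qs') (\<tau> 6) = scan_row_result K s i t qs (\<sigma> 6)"
      unfolding J_def by (auto simp: Suc_length_conv)
    let ?acc = "if 0 < q \<and> block_start K (Suc t') = s then VPair (enc_nat i) (\<tau> 6) else \<tau> 6"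
    have eff: "effect row_step \<tau> = \<tau>(10 := enc_nat (Suc t'), 6 := ?acc, 9 := enc_row qs')"
      by (rule effect_row_step) (use \<sigma> \<tau> same in auto)
    have res': "scan_row_result K s i (Suc t') qs' ?acc = scan_row_result K s i t qs (\<sigma> 6)"
      using res by simp
    have "bounded_state B (effect row_step \<tau>)"
      unfolding eff
    proof (intro bounded_state_upd b)
      show "vsize (enc_nat (Suc t')) \<le> B"
        using vsize_enc_nat_mono[of "Suc t'" "t + length qs"] e end_le by linarith
      show "vsize ?acc \<le> B"
        using vsize_scan_row_ge[of ?acc K s i "Suc t'" qs'] res_le unfolding res' by linarith
      show "vsize (enc_row qs') \<le> B"
        using bounded_stateD[OF b, of 9] \<tau>(1) by simp
    qed
    moreover have "(effect row_step \<tau>) 9 = enc_row qs'" "(effect row_step \<tau>) 10 = enc_nat (Suc t')"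
      "(effect row_step \<tau>) 6 = ?acc" "\<forall>x. x \<notin> {6, 9, 10} \<longrightarrow> (effect row_step \<tau>) x = \<sigma> x"
      unfolding eff using same by auto
    ultimately have "J k (effect row_step \<tau>)"
      unfolding J_def using k e res' by (intro conjI exI[of _ qs'] exI[of _ "Suc t'"]) simp_all
    moreover have "runs ora row_step \<tau> (cost_factor row_step * B) (effect row_step \<tau>)"
      by (rule runs_straight_line[OF _ b]) (simp add: row_step_def)
    moreover have "holds (EIsPair (EVar 9)) \<tau>" using \<tau> by simp
    ultimately show "holds (EIsPair (EVar 9)) \<tau> \<and>
        (\<exists>\<sigma>'. runs ora row_step \<tau> (cost_factor row_step * B) \<sigma>' \<and> J k \<sigma>')" by blast
  qed
  then obtain \<sigma>' where r: "runs ora scan_row \<sigma> (Suc (length qs) * (scan_row_factor * B)) \<sigma>'" and J: "J 0 \<sigma>'"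
    unfolding scan_row_factor_def add_mult_distrib[symmetric] add.assoc by blast
  from J have "bounded_state B \<sigma>'" "\<sigma>' 6 = scan_row_result K s i t qs (\<sigma> 6)"
    "\<forall>x. x \<notin> {6, 9, 10} \<longrightarrow> \<sigma>' x = \<sigma> x"
    unfolding J_def by auto
  with r show ?thesis by blast
qed

definition scan_matrix_factor :: nat where
  "scan_matrix_factor = cost_factor enter_row + cost_factor leave_row + scan_row_factor + 3 + ecost (EIsPair (EVar 8))"

abbreviation enc_rows :: "rat list list \<Rightarrow> val" where
  "enc_rows rs \<equiv> enc_list (map enc_row rs)"

lemma runs_scan_matrix:
  assumes bd: "bounded_state B \<sigma>"
    and \<sigma>: "\<sigma> 1 = enc_nat K" "\<sigma> 3 = enc_nat s" "\<sigma> 7 = enc_nat i" "\<sigma> 8 = enc_rows rs"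
    and len: "\<forall>r\<in>set rs. length r = T"
    and end_le: "vsize (enc_nat (i + length rs)) \<le> B" "vsize (enc_nat T) \<le> B"
    and res_le: "vsize (scan_matrix_result K s i rs (\<sigma> 6)) \<le> B"
  shows "\<exists>\<sigma>'. runs ora scan_matrix \<sigma> (Suc (length rs) * (Suc T * (scan_matrix_factor * B))) \<sigma>' \<and>
    bounded_state B \<sigma>' \<and> \<sigma>' 6 = scan_matrix_result K s i rs (\<sigma> 6) \<and>
    (\<forall>x. x \<notin> {6, 7, 8, 9, 10} \<longrightarrow> \<sigma>' x = \<sigma> x)"
proof -
  let ?a = "1 + cost_factor enter_row * B + (1 + Suc T * (scan_row_factor * B) + cost_factor leave_row * B)"
  let ?b = "(1 + ecost (EIsPair (EVar 8))) * B"
  \<comment> \<open>\<open>set rs' \<subseteq> set rs\<close> hands the common row length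
    \<open>T\<close> on to the rows still unread.\<close>
  define J where "J k \<tau> \<longleftrightarrow> bounded_state B \<tau> \<and> (\<forall>x. x \<notin> {6, 7, 8, 9, 10} \<longrightarrow> \<tau> x = \<sigma> x) \<and>
    (\<exists>rs' i'. k = length rs' \<and> \<tau> 8 = enc_rows rs' \<and> \<tau> 7 = enc_nat i' \<and> i' + k = i + length rs \<and>
      set rs' \<subseteq> set rs \<and>
      scan_matrix_result K s i' rs' (\<tau> 6) = scan_matrix_result K s i rs (\<sigma> 6))" for k \<tau>
  have "\<exists>\<sigma>'. runs ora scan_matrix \<sigma> (Suc (length rs) * (?a + ?b)) \<sigma>' \<and> J 0 \<sigma>'"
    unfolding scan_matrix_def
  proof (rule runs_While)
    show "J (length rs) \<sigma>" unfolding J_def using bd \<sigma> by blast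
    show "1 + expr_cost (EIsPair (EVar 8)) \<tau> \<le> ?b" if "J k \<tau>" for k \<tau>
      using that by (intro guard_cost) (simp add: J_def)
    show "\<not> holds (EIsPair (EVar 8)) \<tau>" if "J 0 \<tau>" for \<tau>
      using that by (auto simp: J_def)
    fix k \<tau> assume J: "J (Suc k) \<tau>"
    then obtain r rs' i' where b: "bounded_state B \<tau>"
      and same: "\<forall>x. x \<notin> {6, 7, 8, 9, 10} \<longrightarrow> \<tau> x = \<sigma> x"
      and k: "k = length rs'" and \<tau>: "\<tau> 8 = enc_rows (r # rs')" "\<tau> 7 = enc_nat i'"
      and e: "Suc i' + k = i + length rs" and sub: "set (r # rs') \<subseteq> set rs"
      and res: "scan_matrix_result K s i' (r # rs') (\<tau> 6) = scan_matrix_result K s i rs (\<sigma> 6)"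
      unfolding J_def by (auto simp: Suc_length_conv)
    let ?acc = "scan_row_result K s (Suc i') 0 r (\<tau> 6)"
    have res': "scan_matrix_result K s (Suc i') rs' ?acc = scan_matrix_result K s i rs (\<sigma> 6)"
      using res by simp
    have acc_le: "vsize ?acc \<le> B"
      using vsize_scan_matrix_ge[of ?acc K s "Suc i'" rs'] res_le unfolding res' by linarith
    have r: "length r = T" using len sub by simp
    have size8: "vsize (enc_row r) \<le> B" "vsize (enc_rows rs') \<le> B"
      using bounded_stateD[OF b, of 8] \<tau>(1) by simp_all
    define \<tau>1 where "\<tau>1 = \<tau>(7 := enc_nat (Suc i'), 9 := enc_row r, 10 := enc_nat 0)"
    have eff1: "effect enter_row \<tau> = \<tau>1"
      using \<tau> by (simp add: enter_row_def \<tau>1_def enc_nat_def add.commute)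
    have run1: "runs ora enter_row \<tau> (cost_factor enter_row * B) \<tau>1"
      unfolding eff1[symmetric] by (rule runs_straight_line[OF _ b]) (simp add: enter_row_def)
    have b1: "bounded_state B \<tau>1"
      unfolding \<tau>1_def
    proof (intro bounded_state_upd b size8)
      show "vsize (enc_nat (Suc i')) \<le> B"
        using vsize_enc_nat_mono[of "Suc i'" "i + length rs"] e end_le by linarith
      show "vsize (enc_nat 0) \<le> B"
        using vsize_enc_nat_mono[of 0 T] end_le by linarith
    qed
    obtain \<tau>2 where run2: "runs ora scan_row \<tau>1 (Suc T * (scan_row_factor * B)) \<tau>2"
      and b2: "bounded_state B \<tau>2" and \<tau>2: "\<tau>2 6 = ?acc" "\<forall>x. x \<notin> {6, 9, 10} \<longrightarrow> \<tau>2 x = \<tau>1 x"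
    proof -
      have \<tau>1_6: "\<tau>1 6 = \<tau> 6" by (simp add: \<tau>1_def)
      have "\<exists>\<sigma>'. runs ora scan_row \<tau>1 (Suc (length r) * (scan_row_factor * B)) \<sigma>' \<and> bounded_state B \<sigma>' \<and>
        \<sigma>' 6 = scan_row_result K s (Suc i') 0 r (\<tau>1 6) \<and> (\<forall>x. x \<notin> {6, 9, 10} \<longrightarrow> \<sigma>' x = \<tau>1 x)"
      proof (rule runs_scan_row[OF b1])
        show "vsize (enc_nat (0 + length r)) \<le> B" using r end_le by simp
        show "vsize (scan_row_result K s (Suc i') 0 r (\<tau>1 6)) \<le> B"
          using acc_le unfolding \<tau>1_6 .
      qed (use \<sigma> same in \<open>auto simp: \<tau>1_def\<close>)
      then show thesis using that unfolding r \<tau>1_6 by blast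
    qed
    define \<tau>3 where "\<tau>3 = \<tau>2(8 := enc_rows rs')"
    have "\<tau>2 8 = enc_rows (r # rs')" using \<tau>2(2) \<tau>(1) by (simp add: \<tau>1_def)
    then have eff3: "effect leave_row \<tau>2 = \<tau>3" by (simp add: leave_row_def \<tau>3_def)
    have run3: "runs ora leave_row \<tau>2 (cost_factor leave_row * B) \<tau>3"
      unfolding eff3[symmetric] by (rule runs_straight_line[OF _ b2]) (simp add: leave_row_def)
    have run: "runs ora (Seq enter_row (Seq scan_row leave_row)) \<tau> ?a \<tau>3"
      by (rule runs_Seq[OF run1 runs_Seq[OF run2 run3]])
    have b3: "bounded_state B \<tau>3" unfolding \<tau>3_def by (intro bounded_state_upd b2 size8)
    have "\<tau>3 8 = enc_rows rs'" "\<tau>3 7 = enc_nat (Suc i')" "\<tau>3 6 = ?acc"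
      "\<forall>x. x \<notin> {6, 7, 8, 9, 10} \<longrightarrow> \<tau>3 x = \<sigma> x"
      using \<tau>2 same by (auto simp: \<tau>3_def \<tau>1_def)
    moreover have "set rs' \<subseteq> set rs" using sub by simp
    ultimately have "J k \<tau>3"
      unfolding J_def using b3 k e res' by (intro conjI exI[of _ rs'] exI[of _ "Suc i'"]) simp_all
    moreover have "holds (EIsPair (EVar 8)) \<tau>" using \<tau> by simp
    ultimately show "holds (EIsPair (EVar 8)) \<tau> \<and>
        (\<exists>\<sigma>'. runs ora (Seq enter_row (Seq scan_row leave_row)) \<tau> ?a \<sigma>' \<and> J k \<sigma>')"
      using run by blast
  qed
  then obtain \<sigma>' where run: "runs ora scan_matrix \<sigma> (Suc (length rs) * (?a + ?b)) \<sigma>'" and J: "J 0 \<sigma>'"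
    by blast
  have "1 \<le> B" by (rule bounded_state_pos[OF bd])
  then have "?a + ?b \<le> Suc T * (scan_matrix_factor * B)"
    unfolding scan_matrix_factor_def by (simp add: algebra_simps)
  then have "runs ora scan_matrix \<sigma> (Suc (length rs) * (Suc T * (scan_matrix_factor * B))) \<sigma>'"
    by (intro runs_mono[OF run] mult_le_mono2)
  moreover from J have "bounded_state B \<sigma>'" "\<sigma>' 6 = scan_matrix_result K s i rs (\<sigma> 6)"
    "\<forall>x. x \<notin> {6, 7, 8, 9, 10} \<longrightarrow> \<sigma>' x = \<sigma> x"
    unfolding J_def by auto
  ultimately show ?thesis by blast
qed

definition period_orders :: "nat \<Rightarrow> rat list list \<Rightarrow> nat \<Rightarrow> val" where
  "period_orders K rs s = scan_matrix_result K s 0 rs (VInt 0)"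

definition serving_row :: "nat \<Rightarrow> nat \<Rightarrow> val" where
  "serving_row K n = enc_list (map (\<lambda>t. enc_nat (block_start K t)) [1..<Suc n])"

definition scan_periods_factor :: nat where
  "scan_periods_factor = cost_factor enter_period + cost_factor leave_period + scan_matrix_factor + 3 +
     ecost (ELess (EInt 0) (EVar 3))"

text \<open>Splits off the largest period, the next one of the downward loop.\<close>

lemma upt_Suc_1: "[1..<Suc (Suc k)] = [1..<Suc k] @ [Suc k]"
  by simp

lemma runs_scan_periods:
  assumes bd: "bounded_state B \<sigma>"
    and \<sigma>: "\<sigma> 1 = enc_nat K" "\<sigma> 2 = enc_rows rs" "\<sigma> 3 = enc_nat n" "\<sigma> 4 = VInt 0" "\<sigma> 5 = VInt 0"
    and len: "\<forall>r\<in>set rs. length r = T"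
    and end_le: "vsize (enc_nat (length rs)) \<le> B" "vsize (enc_nat T) \<le> B"
    and res_le: "vsize (enc_list (map (period_orders K rs) [1..<Suc n])) \<le> B" "vsize (serving_row K n) \<le> B"
  shows "\<exists>\<sigma>'. runs ora scan_periods \<sigma> (Suc n * (Suc (length rs) * Suc T * (scan_periods_factor * B))) \<sigma>' \<and>
    bounded_state B \<sigma>' \<and> \<sigma>' 4 = enc_list (map (period_orders K rs) [1..<Suc n]) \<and>
    \<sigma>' 5 = serving_row K n \<and> (\<forall>x. x \<notin> {3..10} \<longrightarrow> \<sigma>' x = \<sigma> x)"
proof -
  let ?e = "ELess (EInt 0) (EVar 3)" and ?P = "Seq enter_period (Seq scan_matrix leave_period)"
  let ?X = "Suc (length rs) * (Suc T * (scan_matrix_factor * B))"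
  let ?a = "1 + cost_factor enter_period * B + (1 + ?X + cost_factor leave_period * B)"
  let ?b = "(1 + ecost ?e) * B"
  let ?S = "period_orders K rs" and ?g = "\<lambda>t. enc_nat (block_start K t)"
  \<comment> \<open>The accumulated lists are described by what they become once the remaining
    periods \<open>k\<close> down to 1 are prepended.\<close>
  define J where "J k \<tau> \<longleftrightarrow> bounded_state B \<tau> \<and> (\<forall>x. x \<notin> {3..10} \<longrightarrow> \<tau> x = \<sigma> x) \<and> \<tau> 3 = enc_nat k \<and>
    foldr VPair (map ?S [1..<Suc k]) (\<tau> 4) = enc_list (map ?S [1..<Suc n]) \<and>
    foldr VPair (map ?g [1..<Suc k]) (\<tau> 5) = serving_row K n" for k \<tau>
  have "\<exists>\<sigma>'. runs ora scan_periods \<sigma> (Suc n * (?a + ?b)) \<sigma>' \<and> J 0 \<sigma>'"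
    unfolding scan_periods_def
  proof (rule runs_While)
    show "J n \<sigma>" unfolding J_def using bd \<sigma> by (simp add: serving_row_def enc_list_def)
    show "1 + expr_cost ?e \<tau> \<le> ?b" if "J k \<tau>" for k \<tau>
      using that by (intro guard_cost) (simp add: J_def)
    show "\<not> holds ?e \<tau>" if "J 0 \<tau>" for \<tau>
      using that by (simp add: J_def enc_nat_def)
    fix k \<tau> assume J: "J (Suc k) \<tau>"
    then have b: "bounded_state B \<tau>" and same: "\<And>x. x \<notin> {3..10} \<Longrightarrow> \<tau> x = \<sigma> x"
      and \<tau>3: "\<tau> 3 = enc_nat (Suc k)"
      and ord: "foldr VPair (map ?S [1..<Suc k]) (VPair (?S (Suc k)) (\<tau> 4)) = enc_list (map ?S [1..<Suc n])"
      and row: "foldr VPair (map ?g [1..<Suc k]) (VPair (?g (Suc k)) (\<tau> 5)) = serving_row K n"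
      unfolding J_def upt_Suc_1 by simp_all
    have size: "vsize (VPair (?S (Suc k)) (\<tau> 4)) \<le> B" "vsize (VPair (?g (Suc k)) (\<tau> 5)) \<le> B"
      using vsize_foldr_ge[of "VPair (?S (Suc k)) (\<tau> 4)" "map ?S [1..<Suc k]"]
        vsize_foldr_ge[of "VPair (?g (Suc k)) (\<tau> 5)" "map ?g [1..<Suc k]"] res_le
      unfolding ord row by linarith+
    define \<tau>1 where "\<tau>1 = \<tau>(6 := VInt 0, 7 := enc_nat 0, 8 := enc_rows rs)"
    have eff1: "effect enter_period \<tau> = \<tau>1"
      using same[of 2] \<sigma>(2) by (simp add: enter_period_def \<tau>1_def enc_nat_def)
    have run1: "runs ora enter_period \<tau> (cost_factor enter_period * B) \<tau>1"
      unfolding eff1[symmetric] by (rule runs_straight_line[OF _ b]) (simp add: enter_period_def)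
    have b1: "bounded_state B \<tau>1"
      unfolding \<tau>1_def
    proof (intro bounded_state_upd b)
      show "vsize (VInt 0) \<le> B" "vsize (enc_nat 0) \<le> B"
        using bounded_state_pos[OF b] by (simp_all add: enc_nat_def floorlog_def)
      show "vsize (enc_rows rs) \<le> B" using bounded_stateD[OF bd, of 2] \<sigma>(2) by simp
    qed
    have \<tau>1_6: "\<tau>1 6 = VInt 0" by (simp add: \<tau>1_def)
    have "\<exists>\<sigma>'. runs ora scan_matrix \<tau>1 ?X \<sigma>' \<and>
      bounded_state B \<sigma>' \<and> \<sigma>' 6 = scan_matrix_result K (Suc k) 0 rs (\<tau>1 6) \<and>
      (\<forall>x. x \<notin> {6, 7, 8, 9, 10} \<longrightarrow> \<sigma>' x = \<tau>1 x)"
    proof (rule runs_scan_matrix[OF b1])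
      show "vsize (scan_matrix_result K (Suc k) 0 rs (\<tau>1 6)) \<le> B"
        using size(1) unfolding \<tau>1_6 by (simp add: period_orders_def)
      show "\<tau>1 1 = enc_nat K" "\<tau>1 3 = enc_nat (Suc k)" "\<tau>1 7 = enc_nat 0" "\<tau>1 8 = enc_rows rs"
        using same[of 1] \<sigma>(1) \<tau>3 by (simp_all add: \<tau>1_def)
    qed (use len end_le in auto)
    then obtain \<tau>2 where run2: "runs ora scan_matrix \<tau>1 ?X \<tau>2" and b2: "bounded_state B \<tau>2"
      and \<tau>2_6: "\<tau>2 6 = ?S (Suc k)" and \<tau>2: "\<And>x. x \<notin> {6, 7, 8, 9, 10} \<Longrightarrow> \<tau>2 x = \<tau>1 x"
      unfolding \<tau>1_6 period_orders_def by blast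
    define \<tau>3' where "\<tau>3' = \<tau>2(4 := VPair (?S (Suc k)) (\<tau> 4), 5 := VPair (?g (Suc k)) (\<tau> 5), 3 := enc_nat k)"
    \<comment> \<open>\<open>leave_period\<close> evaluates this after overwriting variable 4, hence
      for arbitrary \<open>v\<close>.\<close>
    have "eval_expr (block_start_expr 3) (\<tau>2(4 := v)) = ?g (Suc k)" for v
      by (rule eval_block_start_expr) (use \<tau>2[of 1] \<tau>2[of 3] same[of 1] \<sigma>(1) \<tau>3 in \<open>simp_all add: \<tau>1_def\<close>)
    then have eff3: "effect leave_period \<tau>2 = \<tau>3'"
      using \<tau>2[of 3] \<tau>2[of 4] \<tau>2[of 5] \<tau>2_6 \<tau>3 by (simp add: leave_period_def \<tau>3'_def \<tau>1_def enc_nat_def)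
    have run3: "runs ora leave_period \<tau>2 (cost_factor leave_period * B) \<tau>3'"
      unfolding eff3[symmetric] by (rule runs_straight_line[OF _ b2]) (simp add: leave_period_def)
    have b3: "bounded_state B \<tau>3'"
      unfolding \<tau>3'_def
    proof (intro bounded_state_upd b2 size)
      show "vsize (enc_nat k) \<le> B"
        using vsize_enc_nat_mono[of k "Suc k"] bounded_stateD[OF b, of 3] \<tau>3 by simp
    qed
    have "\<tau>3' x = \<sigma> x" if "x \<notin> {3..10}" for x
    proof -
      have "x \<notin> {6, 7, 8, 9, 10}" "x \<noteq> 3" "x \<noteq> 4" "x \<noteq> 5" using that by auto
      then show ?thesis using \<tau>2[of x] same[OF that] by (simp add: \<tau>3'_def \<tau>1_def)
    qed
    then have "J k \<tau>3'" unfolding J_def using b3 ord row by (simp add: \<tau>3'_def)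
    moreover have "runs ora ?P \<tau> ?a \<tau>3'" by (rule runs_Seq[OF run1 runs_Seq[OF run2 run3]])
    moreover have "holds ?e \<tau>" using \<tau>3 by (simp add: enc_nat_def)
    ultimately show "holds ?e \<tau> \<and> (\<exists>\<sigma>'. runs ora ?P \<tau> ?a \<sigma>' \<and> J k \<sigma>')" by blast
  qed
  then obtain \<sigma>' where run: "runs ora scan_periods \<sigma> (Suc n * (?a + ?b)) \<sigma>'" and J: "J 0 \<sigma>'"
    by blast
  have "?a + ?b \<le> Suc (length rs) * Suc T * (scan_periods_factor * B)"
  proof -
    let ?Y = "Suc (length rs) * Suc T"
    let ?c = "cost_factor enter_period + cost_factor leave_period + 3 + ecost ?e"
    have "1 \<le> B" by (rule bounded_state_pos[OF bd])
    then have "?a + ?b \<le> ?Y * (scan_matrix_factor * B) + 1 * (?c * B)"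
      by (simp add: algebra_simps)
    also have "\<dots> \<le> ?Y * (scan_matrix_factor * B) + ?Y * (?c * B)"
      by (intro add_left_mono mult_le_mono1) simp
    also have "\<dots> = ?Y * (scan_periods_factor * B)"
      unfolding scan_periods_factor_def by (simp only: algebra_simps)
    finally show ?thesis .
  qed
  then have "runs ora scan_periods \<sigma> (Suc n * (Suc (length rs) * Suc T * (scan_periods_factor * B))) \<sigma>'"
    by (intro runs_mono[OF run] mult_le_mono2)
  moreover from J have "bounded_state B \<sigma>'" "\<sigma>' 4 = enc_list (map ?S [1..<Suc n])"
    "\<sigma>' 5 = serving_row K n" "\<forall>x. x \<notin> {3..10} \<longrightarrow> \<sigma>' x = \<sigma> x"
    unfolding J_def by simp_all
  ultimately show ?thesis by blast
qed

definition copy_rows_factor :: nat where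
  "copy_rows_factor = cost_factor copy_row + 1 + ecost (EIsPair (EVar 2))"

text \<open>The matrix in variable 2 now serves only as a unary counter of its rows.\<close>

lemma runs_copy_rows:
  assumes bd: "bounded_state B \<sigma>"
    and \<sigma>: "\<sigma> 2 = enc_list vs" "\<sigma> 5 = r" "\<sigma> 11 = VInt 0"
    and res_le: "vsize (enc_list (replicate (length vs) r)) \<le> B"
  shows "\<exists>\<sigma>'. runs ora copy_rows \<sigma> (Suc (length vs) * (copy_rows_factor * B)) \<sigma>' \<and>
    bounded_state B \<sigma>' \<and> \<sigma>' 11 = enc_list (replicate (length vs) r) \<and>
    (\<forall>x. x \<notin> {2, 11} \<longrightarrow> \<sigma>' x = \<sigma> x)"
proof -
  let ?e = "EIsPair (EVar 2)"
  define J where "J k \<tau> \<longleftrightarrow> bounded_state B \<tau> \<and> (\<forall>x. x \<notin> {2, 11} \<longrightarrow> \<tau> x = \<sigma> x) \<and>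
    (\<exists>vs'. k = length vs' \<and> \<tau> 2 = enc_list vs') \<and>
    foldr VPair (replicate k r) (\<tau> 11) = enc_list (replicate (length vs) r)" for k \<tau>
  have "\<exists>\<sigma>'. runs ora copy_rows \<sigma> (Suc (length vs) * (cost_factor copy_row * B + (1 + ecost ?e) * B)) \<sigma>' \<and> J 0 \<sigma>'"
    unfolding copy_rows_def
  proof (rule runs_While)
    show "J (length vs) \<sigma>" unfolding J_def using bd \<sigma> by (auto simp: enc_list_def)
    show "1 + expr_cost ?e \<tau> \<le> (1 + ecost ?e) * B" if "J k \<tau>" for k \<tau>
      using that by (intro guard_cost) (simp add: J_def)
    show "\<not> holds ?e \<tau>" if "J 0 \<tau>" for \<tau>
      using that by (auto simp: J_def)
    fix k \<tau> assume J: "J (Suc k) \<tau>"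
    \<comment> \<open>All copies are equal, so the next one can be taken from the inner end of the
      \<open>replicate\<close>, next to the accumulator.\<close>
    then obtain v vs' where b: "bounded_state B \<tau>" and same: "\<forall>x. x \<notin> {2, 11} \<longrightarrow> \<tau> x = \<sigma> x"
      and k: "k = length vs'" and \<tau>2: "\<tau> 2 = enc_list (v # vs')"
      and res: "foldr VPair (replicate k r) (VPair r (\<tau> 11)) = enc_list (replicate (length vs) r)"
      unfolding J_def replicate_Suc replicate_append_same[symmetric] by (auto simp: Suc_length_conv)
    define \<tau>' where "\<tau>' = \<tau>(11 := VPair r (\<tau> 11), 2 := enc_list vs')"
    have eff: "effect copy_row \<tau> = \<tau>'"
      using \<tau>2 same \<sigma>(2) by (simp add: copy_row_def \<tau>'_def)
    have "bounded_state B \<tau>'"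
      unfolding \<tau>'_def
    proof (intro bounded_state_upd b)
      show "vsize (VPair r (\<tau> 11)) \<le> B"
        using vsize_foldr_ge[of "VPair r (\<tau> 11)" "replicate k r"] res_le unfolding res by linarith
      show "vsize (enc_list vs') \<le> B" using bounded_stateD[OF b, of 2] \<tau>2 by simp
    qed
    then have "J k \<tau>'" unfolding J_def using same k res by (auto simp: \<tau>'_def)
    moreover have "runs ora copy_row \<tau> (cost_factor copy_row * B) \<tau>'"
      unfolding eff[symmetric] by (rule runs_straight_line[OF _ b]) (simp add: copy_row_def)
    moreover have "holds ?e \<tau>" using \<tau>2 by simp
    ultimately show "holds ?e \<tau> \<and> (\<exists>\<sigma>'. runs ora copy_row \<tau> (cost_factor copy_row * B) \<sigma>' \<and> J k \<sigma>')"
      by blast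
  qed
  then obtain \<sigma>' where "runs ora copy_rows \<sigma> (Suc (length vs) * (copy_rows_factor * B)) \<sigma>'" and J: "J 0 \<sigma>'"
    unfolding copy_rows_factor_def add_mult_distrib[symmetric] add.assoc by blast
  moreover from J have "bounded_state B \<sigma>'" "\<sigma>' 11 = enc_list (replicate (length vs) r)"
    "\<forall>x. x \<notin> {2, 11} \<longrightarrow> \<sigma>' x = \<sigma> x"
    unfolding J_def by simp_all
  ultimately show ?thesis by blast
qed

section \<open>Output size and the polynomial time bound\<close>

definition demand_rows :: "jrp \<Rightarrow> rat list list" where
  "demand_rows I = map (\<lambda>i. map (demand I i) [1..<Suc (num_periods I)]) [1..<Suc (num_elems I)]"

text \<open>Without elements the number of periods may be exponential in the size of the input.\<close>

definition scanned_periods :: "jrp \<Rightarrow> nat" where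
  "scanned_periods I = (if num_elems I = 0 then 0 else num_periods I)"

definition block_output :: "nat \<Rightarrow> jrp \<Rightarrow> val" where
  "block_output K I = VPair (enc_list (map (period_orders K (demand_rows I)) [1..<Suc (scanned_periods I)]))
     (enc_list (replicate (num_elems I) (serving_row K (scanned_periods I))))"

lemma enc_perishable_eq:
  "enc_perishable c I = VPair (enc_nat (num_elems I)) (VPair (enc_nat (num_periods I))
     (VPair (enc_rat c) (VPair (enc_rows (demand_rows I)) (VInt 0))))"
  by (simp add: enc_perishable_def enc_matrix_def demand_rows_def comp_def del: upt_Suc)

lemma length_demand_rows:
  "length (demand_rows I) = num_elems I" "\<forall>r\<in>set (demand_rows I). length r = scanned_periods I"
  by (auto simp: demand_rows_def scanned_periods_def simp del: upt_Suc)

text \<open>The number of periods is itself written in binary; it is the first row of the matrix,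
  with one entry per period, that makes the input long enough. Without rows,
  \<open>scanned_periods\<close> is 0.\<close>

lemma input_dimensions_le:
  "num_elems I \<le> vsize (enc_perishable c I)" "scanned_periods I \<le> vsize (enc_perishable c I)"
proof -
  have *: "vsize (enc_rows (demand_rows I)) \<le> vsize (enc_perishable c I)"
    by (simp add: enc_perishable_eq)
  have "num_elems I \<le> vsize (enc_rows (demand_rows I))"
    using length_le_vsize[of "map enc_row (demand_rows I)"] length_demand_rows(1)[of I] by simp
  with * show "num_elems I \<le> vsize (enc_perishable c I)" by linarith
  show "scanned_periods I \<le> vsize (enc_perishable c I)"
  proof (cases "demand_rows I")
    case Nil
    then have "num_elems I = 0" using length_demand_rows(1)[of I] by simp
    then show ?thesis by (simp add: scanned_periods_def)
  next
    case (Cons r rs)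
    then have "length r = scanned_periods I" using length_demand_rows(2)[of I] by simp
    then have "scanned_periods I \<le> vsize (enc_row r)" using length_le_vsize[of "map enc_rat r"] by simp
    also have "\<dots> \<le> vsize (enc_rows (demand_rows I))" by (rule vsize_member_le) (simp add: Cons)
    finally show ?thesis using * by linarith
  qed
qed

text \<open>Each level of list nesting costs one factor \<open>D\<close>, the 2 in it absorbing pair
  nodes and terminators. An order set may hold an entry for every demand point, which gives
  \<open>D ^ 3\<close>; the final pair takes the fifth factor.\<close>

lemma block_output_sizes:
  assumes "num_elems I \<le> z" "scanned_periods I \<le> z"
  defines "D \<equiv> z + 2"
  shows "vsize (enc_list (map (period_orders K (demand_rows I)) [1..<Suc (scanned_periods I)])) \<le> D ^ 4"
    and "vsize (serving_row K (scanned_periods I)) \<le> D ^ 2"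
    and "vsize (enc_list (replicate (num_elems I) (serving_row K (scanned_periods I)))) \<le> D ^ 3"
    and "vsize (block_output K I) \<le> D ^ 5"
proof -
  let ?N = "num_elems I" and ?n = "scanned_periods I"
  have list_le: "vsize (enc_list vs) \<le> D ^ Suc m"
    if "\<forall>v\<in>set vs. vsize v \<le> D ^ m" "length vs \<le> z" "1 \<le> m" for vs m
  proof -
    have "D ^ 1 \<le> D ^ m" using that(3) by (intro power_increasing) (auto simp: D_def)
    then have m: "1 + z \<le> D ^ m" by (simp add: D_def)
    have "vsize (enc_list vs) \<le> 1 + length vs * Suc (D ^ m)"
      using vsize_foldr_le[OF that(1), of "VInt 0"] by (simp add: enc_list_def floorlog_def)
    also have "\<dots> \<le> 1 + z * Suc (D ^ m)" using that(2) by (intro add_left_mono mult_le_mono1)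
    also have "\<dots> = 1 + z + z * D ^ m" by simp
    also have "\<dots> \<le> D ^ m + z * D ^ m" using m by (rule add_right_mono)
    also have "\<dots> \<le> D * D ^ m" by (simp add: D_def)
    finally show ?thesis by simp
  qed
  have orders: "vsize (period_orders K (demand_rows I) s) \<le> D ^ 3" for s
  proof -
    have "vsize (period_orders K (demand_rows I) s) \<le> 1 + ?N * (?n * (?N + 2))"
      using vsize_scan_matrix_le[OF length_demand_rows(2), of 0 I ?N K s "VInt 0"] length_demand_rows(1)[of I]
      by (simp add: period_orders_def floorlog_def)
    also have "\<dots> \<le> 1 + z * (z * (z + 2))"
      using assms by (intro add_left_mono mult_le_mono) auto
    also have "\<dots> \<le> D ^ 3" by (simp add: D_def power3_eq_cube algebra_simps)
    finally show ?thesis .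
  qed
  then show 4: "vsize (enc_list (map (period_orders K (demand_rows I)) [1..<Suc ?n])) \<le> D ^ 4"
    using list_le[of "map (period_orders K (demand_rows I)) [1..<Suc ?n]" 3] assms(2)
    by (simp add: eval_nat_numeral del: upt_Suc)
  have "vsize (enc_nat (block_start K t)) \<le> D" if "t \<le> z" for t
    using vsize_enc_nat_le[of "block_start K t"] that by (simp add: D_def block_start_def)
  then show 2: "vsize (serving_row K ?n) \<le> D ^ 2"
    unfolding serving_row_def
    using list_le[of "map (\<lambda>t. enc_nat (block_start K t)) [1..<Suc ?n]" 1] assms(2)
    by (simp add: eval_nat_numeral del: upt_Suc)
  then show 3: "vsize (enc_list (replicate ?N (serving_row K ?n))) \<le> D ^ 3"
    using list_le[of "replicate ?N (serving_row K ?n)" 2] assms(1)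
    by (simp add: eval_nat_numeral)
  have "2 \<le> D" "1 \<le> D ^ 3" by (simp_all add: D_def)
  then have "2 * D ^ 3 \<le> D ^ Suc 3" "2 * D ^ 4 \<le> D ^ Suc 4"
    unfolding power_Suc by (intro mult_le_mono1; simp)+
  then have "2 * D ^ 3 \<le> D ^ 4" "2 * D ^ 4 \<le> D ^ 5" by simp_all
  then show "vsize (block_output K I) \<le> D ^ 5"
    using 3 4 \<open>1 \<le> D ^ 3\<close> unfolding block_output_def vsize.simps by linarith
qed

lemma effect_read_input:
  assumes "0 < c"
  shows "effect read_input ((\<lambda>_. VInt 0)(0 := enc_perishable c I)) = (\<lambda>_. VInt 0)(0 := enc_perishable c I,
    1 := enc_nat (life_periods c), 2 := enc_rows (demand_rows I), 3 := enc_nat (scanned_periods I))"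
proof -
  have "\<lfloor>c\<rfloor> = fst (quotient_of c) div snd (quotient_of c)"
  proof -
    have "c = of_int (fst (quotient_of c)) / of_int (snd (quotient_of c))"
      by (rule quotient_of_div) simp
    then show ?thesis by (metis floor_divide_of_int_eq)
  qed
  moreover have "0 \<le> \<lfloor>c\<rfloor>" using assms by simp
  ultimately have "VInt (fst (quotient_of c) div snd (quotient_of c) + 1) = enc_nat (life_periods c)"
    by (simp add: life_periods_def enc_nat_def)
  moreover have "(case enc_rows (demand_rows I) of VInt k \<Rightarrow> False | VPair u v \<Rightarrow> True) \<longleftrightarrow> num_elems I \<noteq> 0"
    using length_demand_rows(1)[of I] by (cases "demand_rows I") auto
  ultimately show ?thesis
    by (simp add: read_input_def enc_perishable_eq Let_def scanned_periods_def enc_nat_def fun_eq_iff)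
qed

definition block_program_factor :: nat where
  "block_program_factor =
     cost_factor read_input + scan_periods_factor + copy_rows_factor + cost_factor write_output + 3"

text \<open>The exponent is 5 + 3: states have size at most \<open>D ^ 5\<close>, and three nested
  loops, over periods, rows and entries, contribute a factor \<open>D\<close> each.\<close>

lemma runs_block_program:
  assumes c: "0 < c"
  shows "\<exists>\<sigma>'. runs ora block_program ((\<lambda>_. VInt 0)(0 := enc_perishable c I))
      (block_program_factor * (vsize (enc_perishable c I) + 2) ^ 8) \<sigma>' \<and>
    \<sigma>' 0 = block_output (life_periods c) I"
proof -
  let ?Z = "vsize (enc_perishable c I)" and ?K = "life_periods c"
  let ?N = "num_elems I" and ?n = "scanned_periods I" and ?rs = "demand_rows I"
  define D where "D = ?Z + 2"
  define B where "B = D ^ 5"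
  define \<sigma>0 :: state where "\<sigma>0 = (\<lambda>_. VInt 0)(0 := enc_perishable c I)"
  define \<sigma>1 where "\<sigma>1 = \<sigma>0(1 := enc_nat ?K, 2 := enc_rows ?rs, 3 := enc_nat ?n)"
  note sizes = block_output_sizes[OF input_dimensions_le(1)[of I c] input_dimensions_le(2)[of I c], folded D_def]
  have D: "2 \<le> D" by (simp add: D_def)
  have powers: "D ^ m \<le> B" if "m \<le> 5" for m
    unfolding B_def using D that by (intro power_increasing) auto
  have DB: "D \<le> B" using powers[of 1] by simp
  have b0: "bounded_state ?Z \<sigma>0"
    using vsize_pos[of "enc_perishable c I"] by (simp add: bounded_state_def \<sigma>0_def floorlog_def)
  have b0': "bounded_state B \<sigma>0"
    by (rule bounded_state_mono[OF b0]) (use DB in \<open>simp add: D_def\<close>)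
  have eff: "effect read_input \<sigma>0 = \<sigma>1"
    using effect_read_input[OF c, of I] by (simp add: \<sigma>0_def \<sigma>1_def)
  have run1: "runs ora read_input \<sigma>0 (cost_factor read_input * B) \<sigma>1"
    unfolding eff[symmetric]
    by (rule runs_straight_line[OF _ b0']) (simp add: read_input_def)
  have nat_le: "vsize (enc_nat m) \<le> B" if "m \<le> ?Z" for m
    using vsize_enc_nat_le[of m] that DB by (simp add: D_def)
  have b1: "bounded_state B \<sigma>1"
    unfolding \<sigma>1_def
  proof (intro bounded_state_upd b0')
    let ?c = "ELeft (ERight (ERight (EVar 0)))"
    let ?e = "EAdd (EDiv (ELeft ?c) (ERight ?c)) (EInt 1)"
    \<comment> \<open>The length of \<open>?K\<close> is bounded through the expression that
      computes it, whose factor \<open>esize ?e\<close> is 4, at most \<open>D ^ 2\<close>.\<close>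
    have "eval_expr ?e \<sigma>0 = enc_nat ?K"
      using fun_cong[OF eff, of 1] by (simp add: read_input_def Let_def \<sigma>1_def)
    then have "vsize (enc_nat ?K) \<le> esize ?e * ?Z" using vsize_eval_le[OF b0, of ?e] by simp
    also have "\<dots> \<le> D ^ 2 * D" by (rule mult_le_mono) (simp_all add: D_def floorlog_def power2_eq_square)
    also have "\<dots> = D ^ 3" by (simp add: eval_nat_numeral)
    also have "\<dots> \<le> B" by (rule powers) simp
    finally show "vsize (enc_nat ?K) \<le> B" .
    show "vsize (enc_rows ?rs) \<le> B" using DB by (simp add: D_def enc_perishable_eq)
    show "vsize (enc_nat ?n) \<le> B" by (rule nat_le[OF input_dimensions_le(2)])
  qed
  have "\<exists>\<sigma>'. runs ora scan_periods \<sigma>1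
      (Suc ?n * (Suc (length ?rs) * Suc ?n * (scan_periods_factor * B))) \<sigma>' \<and>
    bounded_state B \<sigma>' \<and> \<sigma>' 4 = enc_list (map (period_orders ?K ?rs) [1..<Suc ?n]) \<and>
    \<sigma>' 5 = serving_row ?K ?n \<and> (\<forall>x. x \<notin> {3..10} \<longrightarrow> \<sigma>' x = \<sigma>1 x)"
  proof (rule runs_scan_periods[OF b1])
    show "\<forall>r\<in>set ?rs. length r = ?n" by (rule length_demand_rows)
    show "vsize (enc_nat (length ?rs)) \<le> B"
      unfolding length_demand_rows by (rule nat_le[OF input_dimensions_le(1)])
    show "vsize (enc_nat ?n) \<le> B" by (rule nat_le[OF input_dimensions_le(2)])
    show "vsize (enc_list (map (period_orders ?K ?rs) [1..<Suc ?n])) \<le> B"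
      by (rule order_trans[OF sizes(1) powers]) simp
    show "vsize (serving_row ?K ?n) \<le> B"
      by (rule order_trans[OF sizes(2) powers]) simp
  qed (simp_all add: \<sigma>1_def \<sigma>0_def)
  then obtain \<sigma>2 where
    run2: "runs ora scan_periods \<sigma>1 (Suc ?n * (Suc ?N * Suc ?n * (scan_periods_factor * B))) \<sigma>2"
    and b2: "bounded_state B \<sigma>2" and \<sigma>2: "\<sigma>2 4 = enc_list (map (period_orders ?K ?rs) [1..<Suc ?n])"
      "\<sigma>2 5 = serving_row ?K ?n" "\<forall>x. x \<notin> {3..10} \<longrightarrow> \<sigma>2 x = \<sigma>1 x"
    unfolding length_demand_rows by blast
  let ?vs = "map enc_row ?rs"
  have len: "length ?vs = ?N" by (simp add: length_demand_rows)
  have "\<exists>\<sigma>'. runs ora copy_rows \<sigma>2 (Suc (length ?vs) * (copy_rows_factor * B)) \<sigma>' \<and>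
    bounded_state B \<sigma>' \<and> \<sigma>' 11 = enc_list (replicate (length ?vs) (serving_row ?K ?n)) \<and>
    (\<forall>x. x \<notin> {2, 11} \<longrightarrow> \<sigma>' x = \<sigma>2 x)"
  proof (rule runs_copy_rows[OF b2])
    show "\<sigma>2 2 = enc_list ?vs" "\<sigma>2 11 = VInt 0" using \<sigma>2(3) by (simp_all add: \<sigma>1_def \<sigma>0_def)
    show "\<sigma>2 5 = serving_row ?K ?n" by (rule \<sigma>2)
    show "vsize (enc_list (replicate (length ?vs) (serving_row ?K ?n))) \<le> B"
      unfolding len by (rule order_trans[OF sizes(3) powers]) simp
  qed
  then obtain \<sigma>3 where run3: "runs ora copy_rows \<sigma>2 (Suc ?N * (copy_rows_factor * B)) \<sigma>3"
    and b3: "bounded_state B \<sigma>3" and \<sigma>3: "\<sigma>3 11 = enc_list (replicate ?N (serving_row ?K ?n))"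
      "\<forall>x. x \<notin> {2, 11} \<longrightarrow> \<sigma>3 x = \<sigma>2 x"
    unfolding len by blast
  have run4: "runs ora write_output \<sigma>3 (cost_factor write_output * B) (effect write_output \<sigma>3)"
    by (rule runs_straight_line[OF _ b3]) (simp add: write_output_def)
  have out: "(effect write_output \<sigma>3) 0 = block_output ?K I"
    using \<sigma>3 \<sigma>2(1) by (simp add: write_output_def block_output_def)
  let ?time = "1 + cost_factor read_input * B + (1 + Suc ?n * (Suc ?N * Suc ?n * (scan_periods_factor * B)) +
    (1 + Suc ?N * (copy_rows_factor * B) + cost_factor write_output * B))"
  have "runs ora block_program \<sigma>0 ?time (effect write_output \<sigma>3)"
    unfolding block_program_def by (rule runs_Seq[OF run1 runs_Seq[OF run2 runs_Seq[OF run3 run4]]])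
  moreover have "?time \<le> block_program_factor * D ^ 8"
  proof -
    have dims: "Suc ?N \<le> D" "Suc ?n \<le> D" using input_dimensions_le[of I c] by (auto simp: D_def)
    have D3: "1 \<le> D ^ 3" "D ^ 1 \<le> D ^ 3" using D by (simp, intro power_increasing) auto
    have "1 \<le> B" using DB D by simp
    then have "?time \<le> 1 * ((cost_factor read_input + cost_factor write_output + 3) * B) +
        (Suc ?n * Suc ?N * Suc ?n) * (scan_periods_factor * B) + Suc ?N * (copy_rows_factor * B)"
      by (simp add: algebra_simps)
    also have "\<dots> \<le> D ^ 3 * ((cost_factor read_input + cost_factor write_output + 3) * B) +
        D ^ 3 * (scan_periods_factor * B) + D ^ 3 * (copy_rows_factor * B)"
    proof (intro add_mono mult_le_mono1)
      show "Suc ?n * Suc ?N * Suc ?n \<le> D ^ 3"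
        unfolding power3_eq_cube by (intro mult_le_mono dims)
      show "Suc ?N \<le> D ^ 3" using dims(1) D3(2) by simp
    qed (rule D3)
    also have "\<dots> = block_program_factor * (D ^ 3 * B)"
      unfolding block_program_factor_def by (simp add: algebra_simps)
    also have "D ^ 3 * B = D ^ 8" by (simp add: B_def power_add[symmetric])
    finally show ?thesis .
  qed
  ultimately have "runs ora block_program \<sigma>0 (block_program_factor * D ^ 8) (effect write_output \<sigma>3)"
    by (rule runs_mono)
  then show ?thesis using out unfolding \<sigma>0_def D_def by blast
qed

section \<open>Decoding the output\<close>

lemma dec_nth_VInt: "dec_nth (VInt 0) k = VInt 0"
proof -
  have "(right_of ^^ k) (VInt 0) = VInt 0" by (induction k) auto
  then show ?thesis by (simp add: dec_nth_def)
qed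

lemma approx_dec_block_output:
  assumes "perishable c I" "0 < c" "monotone_subadditive_cost I" "2 \<le> \<alpha>"
  shows "approx_solution \<alpha> I (dec_schedule (block_output (life_periods c) I))"
proof (rule block_schedule_approx[OF assms(3,2,1) _ _ assms(4)])
  let ?K = "life_periods c" and ?n = "scanned_periods I"
  fix s assume s: "s \<in> {1..num_periods I}"
  show "orders (dec_schedule (block_output ?K I)) s = block_orders ?K I s"
  proof (cases "num_elems I = 0")
    \<comment> \<open>The list of order sets is empty; reading past its end yields
      \<open>VInt 0\<close>, which decodes to the empty set, as required.\<close>
    case True
    then show ?thesis
      by (simp add: dec_schedule_def block_output_def scanned_periods_def dec_nth_VInt
          block_orders_def demand_points_def elements_def)
  next
    case False
    then have n: "?n = num_periods I" by (simp add: scanned_periods_def)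
    have "dec_nth (enc_list (map (period_orders ?K (demand_rows I)) [1..<Suc ?n])) (s - 1)
        = period_orders ?K (demand_rows I) s"
      using s n by (subst dec_nth_enc_list) (auto simp del: upt_Suc)
    then have "orders (dec_schedule (block_output ?K I)) s = dec_set (period_orders ?K (demand_rows I) s)"
      by (simp add: dec_schedule_def block_output_def)
    also have "\<dots> = {j. \<exists>m<num_elems I. j = Suc m \<and>
        (\<exists>k<num_periods I. 0 < demand I (Suc m) (Suc k) \<and> block_start ?K (Suc k) = s)}"
      by (simp add: set_eq_iff period_orders_def dec_set_scan_matrix demand_rows_def del: upt_Suc cong: conj_cong)
    also have "\<dots> = block_orders ?K I s"
    proof (intro set_eqI iffI)
      fix j assume "j \<in> block_orders ?K I s"
      then obtain t where "j \<in> {1..num_elems I}" "t \<in> {1..num_periods I}" "0 < demand I j t" "block_start ?K t = s"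
        by (auto simp: block_orders_def demand_points_def elements_def)
      then show "j \<in> {j. \<exists>m<num_elems I. j = Suc m \<and>
          (\<exists>k<num_periods I. 0 < demand I (Suc m) (Suc k) \<and> block_start ?K (Suc k) = s)}"
        by (intro CollectI exI[of _ "j - 1"] exI[of _ "t - 1"] conjI) auto
    next
      fix j assume "j \<in> {j. \<exists>m<num_elems I. j = Suc m \<and>
          (\<exists>k<num_periods I. 0 < demand I (Suc m) (Suc k) \<and> block_start ?K (Suc k) = s)}"
      then obtain k where "j \<in> {1..num_elems I}" "k < num_periods I" "0 < demand I j (Suc k)"
        "block_start ?K (Suc k) = s" by auto
      then show "j \<in> block_orders ?K I s"
        by (auto simp: block_orders_def demand_points_def elements_def intro!: exI[of _ "Suc k"])
    qed
    finally show ?thesis .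
  qed
next
  let ?K = "life_periods c" and ?n = "scanned_periods I"
  fix i t assume "(i, t) \<in> demand_points I"
  then have it: "i \<in> {1..num_elems I}" "t \<in> {1..num_periods I}"
    by (auto simp: demand_points_def elements_def)
  then have n: "?n = num_periods I" by (simp add: scanned_periods_def)
  have "dec_nth (enc_list (replicate (num_elems I) (serving_row ?K ?n))) (i - 1) = serving_row ?K ?n"
    using it by (subst dec_nth_enc_list) auto
  moreover have "dec_nth (serving_row ?K ?n) (t - 1) = enc_nat (block_start ?K t)"
    unfolding serving_row_def using it n by (subst dec_nth_enc_list) (auto simp del: upt_Suc)
  ultimately show "source (dec_schedule (block_output ?K I)) i t = block_start ?K t"
    by (simp add: dec_schedule_def block_output_def enc_nat_def)
qed

lemma block_program_computes:
  assumes "0 < c"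
  shows "\<exists>n. computes ora block_program (enc_perishable c I) n (block_output (life_periods c) I) \<and>
    n \<le> block_program_factor * (vsize (enc_perishable c I) + 2) ^ 8"
  using runs_block_program[OF assms, of ora I] unfolding runs_def computes_def by blast

theorem theorem2:
  shows
    "(\<exists>(P :: com) (p :: nat poly). \<forall>(I :: jrp) (c :: rat).
        submodular_jrp I \<and> 0 < c \<and> perishable c I \<longrightarrow>
        (\<exists>n out. computes (value_oracle I) P (enc_perishable c I) n out \<and>
           n \<le> poly p (vsize (enc_perishable c I) + max_value_size I) \<and>
           approx_solution 2 I (dec_schedule out)))
     \<and>
     (\<exists>(Q :: com) (q :: nat poly) (\<epsilon> :: nat \<Rightarrow> real). \<epsilon> \<longlonglongrightarrow> 0 \<and>
        (\<forall>(I :: jrp) (w :: nat \<Rightarrow> nat \<Rightarrow> rat) (c :: rat).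
           irp w I \<and> 0 < c \<and> perishable c I \<longrightarrow>
           (\<exists>n out. computes no_oracle Q (enc_perishable_irp c w I) n out \<and>
              n \<le> poly q (vsize (enc_perishable_irp c w I)) \<and>
              approx_solution (6 + \<epsilon> (num_elems I + 1)) I (dec_schedule out))))"
proof (intro conjI)
  let ?F = block_program_factor
  let ?p = "smult ?F ([:2, 1:] ^ 8)"
  have poly_p: "poly ?p x = ?F * (x + 2) ^ 8" for x
    by (simp add: poly_power add.commute)
  show "\<exists>(P :: com) (p :: nat poly). \<forall>(I :: jrp) (c :: rat).
        submodular_jrp I \<and> 0 < c \<and> perishable c I \<longrightarrow>
        (\<exists>n out. computes (value_oracle I) P (enc_perishable c I) n out \<and>
           n \<le> poly p (vsize (enc_perishable c I) + max_value_size I) \<and>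
           approx_solution 2 I (dec_schedule out))"
  proof (intro exI[of _ block_program] exI[of _ ?p] allI impI)
    fix I :: jrp and c :: rat
    assume I: "submodular_jrp I \<and> 0 < c \<and> perishable c I"
    obtain n where n: "computes (value_oracle I) block_program (enc_perishable c I) n (block_output (life_periods c) I)"
      "n \<le> ?F * (vsize (enc_perishable c I) + 2) ^ 8"
      using block_program_computes I by blast
    note n(2)
    also have "?F * (vsize (enc_perishable c I) + 2) ^ 8 \<le> poly ?p (vsize (enc_perishable c I) + max_value_size I)"
      unfolding poly_p by (intro mult_le_mono2 power_mono) auto
    finally show "\<exists>n out. computes (value_oracle I) block_program (enc_perishable c I) n out \<and>
        n \<le> poly ?p (vsize (enc_perishable c I) + max_value_size I) \<and> approx_solution 2 I (dec_schedule out)"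
      using n(1) I approx_dec_block_output[of c I 2] submodular_jrp_monotone_subadditive by blast
  qed
  \<comment> \<open>The routing program discards the distance matrix and keeps the first entry of
    its input.\<close>
  let ?Q = "Seq (Assign 0 (ELeft (EVar 0))) block_program"
  \<comment> \<open>The additional 4 pays for the extra assignment.\<close>
  let ?q = "smult (?F + 4) ([:2, 1:] ^ 8)"
  have poly_q: "poly ?q x = (?F + 4) * (x + 2) ^ 8" for x
    by (simp add: poly_power add.commute)
  show "\<exists>(Q :: com) (q :: nat poly) (\<epsilon> :: nat \<Rightarrow> real). \<epsilon> \<longlonglongrightarrow> 0 \<and>
        (\<forall>(I :: jrp) (w :: nat \<Rightarrow> nat \<Rightarrow> rat) (c :: rat).
           irp w I \<and> 0 < c \<and> perishable c I \<longrightarrow>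
           (\<exists>n out. computes no_oracle Q (enc_perishable_irp c w I) n out \<and>
              n \<le> poly q (vsize (enc_perishable_irp c w I)) \<and>
              approx_solution (6 + \<epsilon> (num_elems I + 1)) I (dec_schedule out)))"
  \<comment> \<open>The zero sequence will do for \<open>\<epsilon>\<close>, since the guarantee 2
    already lies below 6.\<close>
  proof (intro exI[of _ ?Q] exI[of _ ?q] exI[of _ "\<lambda>_. 0"] conjI allI impI)
    fix I :: jrp and w :: "nat \<Rightarrow> nat \<Rightarrow> rat" and c :: rat
    assume I: "irp w I \<and> 0 < c \<and> perishable c I"
    let ?inp = "enc_perishable_irp c w I" and ?out = "block_output (life_periods c) I"
    let ?\<sigma> = "(\<lambda>_. VInt 0)(0 := ?inp) :: state"
    obtain n \<sigma>' where n: "exec no_oracle block_program ((\<lambda>_. VInt 0)(0 := enc_perishable c I)) n \<sigma>'" "\<sigma>' 0 = ?out"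
      "n \<le> ?F * (vsize (enc_perishable c I) + 2) ^ 8"
      using block_program_computes I unfolding computes_def by blast
    have left: "left_of ?inp = enc_perishable c I" by (simp add: enc_perishable_irp_def)
    let ?m = "1 + (1 + expr_cost (ELeft (EVar 0)) ?\<sigma>) + n"
    have "exec no_oracle ?Q ?\<sigma> ?m \<sigma>'"
    proof (rule exec_Seq[OF exec_Assign])
      show "exec no_oracle block_program (?\<sigma>(0 := eval_expr (ELeft (EVar 0)) ?\<sigma>)) n \<sigma>'"
        using n(1) left by simp
    qed
    then have "computes no_oracle ?Q ?inp ?m ?out"
      using n(2) unfolding computes_def by blast
    moreover have "?m \<le> poly ?q (vsize ?inp)"
    proof -
      have z: "vsize (enc_perishable c I) \<le> vsize ?inp" by (simp add: enc_perishable_irp_def)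
      have "?F * (vsize (enc_perishable c I) + 2) ^ 8 \<le> ?F * (vsize ?inp + 2) ^ 8"
        using z by (intro mult_le_mono2 power_mono) auto
      moreover have "1 + (1 + expr_cost (ELeft (EVar 0)) ?\<sigma>) \<le> 2 * (vsize ?inp + 2) ^ 1"
        using left z by simp
      moreover have "(vsize ?inp + 2) ^ 1 \<le> (vsize ?inp + 2) ^ 8"
        by (rule power_increasing) auto
      ultimately show ?thesis unfolding poly_q add_mult_distrib using n(3) by linarith
    qed
    moreover have "approx_solution (6 + 0) I (dec_schedule ?out)"
      using I irp_monotone_subadditive by (intro approx_dec_block_output) auto
    ultimately show "\<exists>n out. computes no_oracle ?Q ?inp n out \<and> n \<le> poly ?q (vsize ?inp) \<and>
        approx_solution (6 + 0) I (dec_schedule out)" by blast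
  qed simp
qed

end
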